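(* Let $t\geq 1$ be an integer and $\varepsilon>0$. There is a constant $C=C(\varepsilon,t)$ such that every graph $G$ with $n$ vertices and average degree $d(G)\geq c(t)+\varepsilon$ contains a $K_t$-minor consisting of at most $C\log n$ vertices (i.e. $O_{\varepsilon,t}(\log n)$ vertices).
   Context: All graphs are finite and simple; $d(G)=2e(G)/|V(G)|$ is the average degree and $\log$ is the natural logarithm. $c(t)$ denotes the smallest real number $c$ such that every graph with $d(G)\geq c$ has $K_t$ as a minor (this minimum exists). A graph $G$ "contains a $K_t$-minor consisting of at most $N$ vertices" if there is a subgraph of $G$ with at most $N$ vertices which has $K_t$ as a minor (equivalently, there are $t$ pairwise disjoint vertex sets, each inducing a connected subgraph, with an edge between every two of them, of total size at most $N$). *)

theory Defs
  imports Complex_Main "HOL-Library.Disjoint_Sets" "Graph_Theory.Kuratowski"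
begin

text \<open>
  A finite simple graph is a \<open>pair_graph\<close> of \<open>Graph_Theory\<close>: a finite, loop-free, symmetric
  digraph without parallel arcs. An undirected edge \<open>uv\<close> is the pair of arcs \<open>(u,v)\<close>, \<open>(v,u)\<close>.
  The null graph, which has no average degree, is excluded.
\<close>

definition simple_graph :: "'a pair_pre_digraph \<Rightarrow> bool" where
  "simple_graph G \<longleftrightarrow> pair_graph G \<and> pverts G \<noteq> {}"

definition edge_set :: "'a pair_pre_digraph \<Rightarrow> 'a set set" where
  "edge_set G = {{u, v} | u v. (u, v) \<in> parcs G}"

definition avg_degree :: "'a pair_pre_digraph \<Rightarrow> real" where
  "avg_degree G = 2 * real (card (edge_set G)) / real (card (pverts G))"

text \<open>
  \<open>minor_of H G\<close>: \<open>H\<close> is a minor of \<open>G\<close>, where \<open>B v\<close> is the branch set that is contracted to the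
  vertex \<open>v\<close> of \<open>H\<close>. The library's \<open>connected\<close> (not the topological one) requires a nonempty
  vertex set.
\<close>

definition minor_of :: "'b pair_pre_digraph \<Rightarrow> 'a pair_pre_digraph \<Rightarrow> bool" where
  "minor_of H G \<longleftrightarrow> (\<exists>B.
     (\<forall>v \<in> pverts H. B v \<subseteq> pverts G \<and> Digraph_Component.connected (with_proj G \<restriction> B v)) \<and>
     disjoint_family_on B (pverts H) \<and>
     (\<forall>(u, v) \<in> parcs H. \<exists>x \<in> B u. \<exists>y \<in> B v. (x, y) \<in> parcs G))"

definition complete_graph :: "nat \<Rightarrow> nat pair_pre_digraph" where
  "complete_graph t = \<lparr> pverts = {..<t}, parcs = {(u, v). u < t \<and> v < t \<and> u \<noteq> v} \<rparr>"

lemma complete_digraph_complete_graph: "K\<^bsub>t\<^esub> (with_proj (complete_graph t))"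
  by (auto simp: complete_digraph_pair_def complete_graph_def)

definition has_complete_minor :: "nat \<Rightarrow> 'a pair_pre_digraph \<Rightarrow> bool" where
  "has_complete_minor t G \<longleftrightarrow> minor_of (complete_graph t) G"

definition has_complete_minor_within :: "nat \<Rightarrow> 'a pair_pre_digraph \<Rightarrow> real \<Rightarrow> bool" where
  "has_complete_minor_within t G N \<longleftrightarrow>
     (\<exists>H. simple_graph H \<and> subgraph (with_proj H) (with_proj G) \<and>
          real (card (pverts H)) \<le> N \<and> has_complete_minor t H)"

text \<open>
  Every finite graph is isomorphic to one with vertices in \<open>nat\<close>, so quantifying over these
  covers all finite graphs.
\<close>

definition forces_complete_minor :: "nat \<Rightarrow> real \<Rightarrow> bool" where
  "forces_complete_minor t c \<longleftrightarrow>
     (\<forall>G :: nat pair_pre_digraph. simple_graph G \<longrightarrow> avg_degree G \<ge> c \<longrightarrow> has_complete_minor t G)"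

text \<open>
  \<open>c(t)\<close> is the smallest \<open>c\<close> such that average degree at least \<open>c\<close> forces a \<open>K\<^sub>t\<close>-minor. For
  \<open>t = 2\<close> the admissible \<open>c\<close> are exactly the positive reals, and for \<open>t = 1\<close> all reals are
  admissible, so no minimum exists; the infimum over nonnegative \<open>c\<close> gives \<open>0\<close> in both cases.
  Whenever the minimum exists, this is the minimum (\<open>minor_threshold_eq_minimum\<close>).
\<close>

definition minor_threshold :: "nat \<Rightarrow> real" where
  "minor_threshold t = Inf {c. 0 \<le> c \<and> forces_complete_minor t c}"

lemma minor_threshold_eq_minimum:
  assumes c: "forces_complete_minor t c"
    and least: "\<And>c'. forces_complete_minor t c' \<Longrightarrow> c \<le> c'"
  shows "minor_threshold t = c"
proof -
  have nonneg: "0 \<le> avg_degree G" for G :: "nat pair_pre_digraph"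
    by (simp add: avg_degree_def)
  have "0 \<le> c"
  proof (rule ccontr)
    assume "\<not> 0 \<le> c"
    then have "avg_degree G \<ge> c" for G :: "nat pair_pre_digraph"
      using nonneg[of G] by linarith
    with c have "forces_complete_minor t (c - 1)"
      by (simp add: forces_complete_minor_def)
    from least[OF this] show False by simp
  qed
  with c least show ?thesis
    unfolding minor_threshold_def by (intro cInf_eq_minimum) auto
qed

end

theory Submission
  imports Defs "HOL-Real_Asymp.Real_Asymp"
begin

text \<open>
  Among the subgraphs on \<open>m\<close> vertices whose average degree is at least
  \<open>\<theta>(m) = c + e (1 - 1 / (1 + ln m) + ln m / ln n)\<close>, where \<open>c\<close> forces a \<open>K\<^sub>t\<close>-minor, take one
  with \<open>m\<close> minimal. If \<open>m\<close> is bounded, this subgraph itself has a \<open>K\<^sub>t\<close>-minor. Otherwise minimality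
  makes it an expander: every set \<open>S\<close> of at most \<open>m\<^bsup>1-1/g\<^esup>/2\<close> vertices has at least \<open>\<rho> |S|\<close> outer
  neighbours, where \<open>\<rho>\<close> is of order \<open>ln m (1 / (1 + ln m)\<^sup>2 + 1 / ln n)\<close>. So balls reach size
  \<open>m\<^bsup>1-1/g\<^esup>/2\<close> within a radius \<open>r\<close> that is both \<open>O(ln n)\<close> and polylogarithmic in \<open>m\<close>, even after
  the deletion of few vertices.

  Fix many disjoint connected ``units'', of size a small power of \<open>m\<close> and of radius \<open>r\<close>. Balls around
  more than \<open>2m\<^bsup>1/g\<^esup>\<close> units cannot be disjoint, so any that many units include two that are linked
  by a path of length \<open>O(r)\<close> even after deleting any small vertex set. By a Ramsey argument \<open>t\<close> units
  are pairwise robustly linked, and by a first moment argument they can be chosen such that each link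
  also avoids the other chosen units. Choosing disjoint links one after the other gives the minor.
\<close>

section \<open>Connected sets and clique minors\<close>

text \<open>Connectivity of the induced subgraph, stated on bare arc sets so that branch sets can be
  built by set operations. Nonemptiness is included, as in the library's
  \<open>connected\<close>.\<close>

definition linked :: "('a \<times> 'a) set \<Rightarrow> 'a set \<Rightarrow> bool" where
  "linked E X \<longleftrightarrow> X \<noteq> {} \<and> (\<forall>x\<in>X. \<forall>y\<in>X. (x, y) \<in> (E \<inter> X \<times> X)\<^sup>*)"

lemma linked_singleton [simp]: "linked E {x}"
  by (simp add: linked_def)

lemma linked_Un:
  assumes X: "linked E X" and Y: "linked E Y" and xy: "x \<in> X" "y \<in> Y" "(x, y) \<in> E" and "sym E"
  shows "linked E (X \<union> Y)"
proof -
  let ?R = "E \<inter> (X \<union> Y) \<times> (X \<union> Y)"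
  have "(E \<inter> X \<times> X)\<^sup>* \<subseteq> ?R\<^sup>*" "(E \<inter> Y \<times> Y)\<^sup>* \<subseteq> ?R\<^sup>*"
    by (intro rtrancl_mono; blast)+
  then have inX: "\<And>u v. u \<in> X \<Longrightarrow> v \<in> X \<Longrightarrow> (u, v) \<in> ?R\<^sup>*"
    and inY: "\<And>u v. u \<in> Y \<Longrightarrow> v \<in> Y \<Longrightarrow> (u, v) \<in> ?R\<^sup>*"
    using X Y unfolding linked_def by blast+
  have "(x, y) \<in> ?R\<^sup>*" "(y, x) \<in> ?R\<^sup>*"
    using xy \<open>sym E\<close> by (auto dest: symD intro!: r_into_rtrancl)
  then have "(u, v) \<in> ?R\<^sup>* \<and> (v, u) \<in> ?R\<^sup>*" if "u \<in> X" "v \<in> Y" for u v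
    using inX[OF that(1) xy(1)] inY[OF xy(2) that(2)] inX[OF xy(1) that(1)] inY[OF that(2) xy(2)]
    by (meson rtrancl_trans)
  then show ?thesis
    using inX inY X by (auto simp: linked_def)
qed

lemma linked_insert:
  assumes "linked E X" "x \<in> X" "(x, y) \<in> E" "sym E"
  shows "linked E (insert y X)"
  using linked_Un[OF assms(1) linked_singleton[of E y] assms(2) _ assms(3,4)] by simp

lemma linked_UN:
  assumes "I \<noteq> {}" and X: "\<And>i. i \<in> I \<Longrightarrow> linked E (X i)" and v: "\<And>i. i \<in> I \<Longrightarrow> v \<in> X i"
  shows "linked E (\<Union>i\<in>I. X i)"
proof -
  let ?U = "\<Union>i\<in>I. X i"
  let ?R = "E \<inter> ?U \<times> ?U"
  have in_part: "(x, y) \<in> ?R\<^sup>*" if i: "i \<in> I" "x \<in> X i" "y \<in> X i" for i x y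
  proof -
    have "(E \<inter> X i \<times> X i)\<^sup>* \<subseteq> ?R\<^sup>*"
      using i by (intro rtrancl_mono) blast
    then show ?thesis using X[OF i(1)] i by (auto simp: linked_def)
  qed
  have "(x, y) \<in> ?R\<^sup>*" if "x \<in> ?U" "y \<in> ?U" for x y
  proof -
    from that obtain i j where "i \<in> I" "x \<in> X i" "j \<in> I" "y \<in> X j" by auto
    then show ?thesis using in_part v by (meson rtrancl_trans)
  qed
  then show ?thesis using assms by (fastforce simp: linked_def)
qed

lemma linked_Un_common:
  assumes "linked E X" "linked E Y" "v \<in> X" "v \<in> Y"
  shows "linked E (X \<union> Y)"
  using linked_UN[of "{X, Y}" E "\<lambda>X. X" v] assms by auto

lemma linked_mono:
  assumes "linked E X" "E \<inter> X \<times> X \<subseteq> E'"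
  shows "linked E' X"
proof -
  have "(E \<inter> X \<times> X)\<^sup>* \<subseteq> (E' \<inter> X \<times> X)\<^sup>*"
    using assms(2) by (intro rtrancl_mono) blast
  then show ?thesis using assms(1) by (auto simp: linked_def)
qed

lemma linked_image:
  assumes "linked E X" "(map_prod f f ` (E \<inter> X \<times> X)) \<subseteq> E'"
  shows "linked E' (f ` X)"
proof -
  have "(f x, f y) \<in> (E' \<inter> f ` X \<times> f ` X)\<^sup>*" if "(x, y) \<in> (E \<inter> X \<times> X)\<^sup>*" for x y
    using that
  proof induction
    case (step y z)
    then have "(f y, f z) \<in> E' \<inter> f ` X \<times> f ` X"
      using assms(2) by (auto simp: map_prod_def)
    with step.IH show ?case by (rule rtrancl_into_rtrancl)
  qed simp
  then show ?thesis using assms(1) by (auto simp: linked_def)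
qed

text \<open>\<open>E\<close> may exceed \<open>V \<times> V\<close>, so that \<open>V\<close> can be
  varied while \<open>E\<close> stays fixed. For symmetric \<open>E\<close>, the pairs with
  \<open>j < i\<close> cover all adjacencies.\<close>

definition clique_minor :: "('a \<times> 'a) set \<Rightarrow> nat \<Rightarrow> 'a set \<Rightarrow> bool" where
  "clique_minor E t V \<longleftrightarrow> (\<exists>B. (\<forall>i<t. B i \<subseteq> V \<and> linked E (B i)) \<and> disjoint_family_on B {..<t} \<and>
     (\<forall>i<t. \<forall>j<i. \<exists>x\<in>B i. \<exists>y\<in>B j. (x, y) \<in> E))"

lemma clique_minor_mono:
  assumes "clique_minor E t V" "V \<subseteq> V'" "E \<subseteq> E'"
  shows "clique_minor E' t V'"
proof -
  from assms(1) obtain B where B: "\<forall>i<t. B i \<subseteq> V \<and> linked E (B i)" "disjoint_family_on B {..<t}"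
      "\<forall>i<t. \<forall>j<i. \<exists>x\<in>B i. \<exists>y\<in>B j. (x, y) \<in> E"
    unfolding clique_minor_def by blast
  have "B i \<subseteq> V' \<and> linked E' (B i)" if "i < t" for i
    using B(1) that assms(2,3) linked_mono[of E "B i" E'] by blast
  moreover have "\<exists>x\<in>B i. \<exists>y\<in>B j. (x, y) \<in> E'" if "i < t" "j < i" for i j
    using B(3) that assms(3) by blast
  ultimately show ?thesis
    unfolding clique_minor_def using B(2) by blast
qed

lemma clique_minor_restrict:
  assumes "clique_minor E t V"
  shows "clique_minor (E \<inter> V \<times> V) t V"
proof -
  from assms obtain B where B: "\<forall>i<t. B i \<subseteq> V \<and> linked E (B i)" "disjoint_family_on B {..<t}"
      "\<forall>i<t. \<forall>j<i. \<exists>x\<in>B i. \<exists>y\<in>B j. (x, y) \<in> E"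
    unfolding clique_minor_def by blast
  have "linked (E \<inter> V \<times> V) (B i)" if "i < t" for i
  proof (rule linked_mono)
    show "linked E (B i)" using B(1) that by blast
    have "B i \<subseteq> V" using B(1) that by blast
    then show "E \<inter> B i \<times> B i \<subseteq> E \<inter> V \<times> V" by blast
  qed
  moreover have "\<exists>x\<in>B i. \<exists>y\<in>B j. (x, y) \<in> E \<inter> V \<times> V" if "i < t" "j < i" for i j
  proof -
    from B(3) that obtain x y where "x \<in> B i" "y \<in> B j" "(x, y) \<in> E" by blast
    moreover have "B i \<subseteq> V" "B j \<subseteq> V" using B(1) that by auto
    ultimately show ?thesis by blast
  qed
  ultimately show ?thesis
    unfolding clique_minor_def using B by blast
qed

lemma clique_minor_image:
  assumes "clique_minor E t V" "inj_on f V" "E \<subseteq> V \<times> V"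
  shows "clique_minor (map_prod f f ` E) t (f ` V)"
proof -
  from assms(1) obtain B where B: "\<forall>i<t. B i \<subseteq> V \<and> linked E (B i)" "disjoint_family_on B {..<t}"
      "\<forall>i<t. \<forall>j<i. \<exists>x\<in>B i. \<exists>y\<in>B j. (x, y) \<in> E"
    unfolding clique_minor_def by blast
  have "linked (map_prod f f ` E) (f ` B i)" if "i < t" for i
    using B(1) that by (intro linked_image[of E]) auto
  moreover have "disjoint_family_on (\<lambda>i. f ` B i) {..<t}"
    using B(1,2) assms(2) unfolding disjoint_family_on_def inj_on_def by blast
  moreover have "\<exists>x\<in>f ` B i. \<exists>y\<in>f ` B j. (x, y) \<in> map_prod f f ` E" if "i < t" "j < i" for i j
    using B(3) that by fastforce
  moreover have "f ` B i \<subseteq> f ` V" if "i < t" for i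
    using B(1) that by blast
  ultimately show ?thesis
    unfolding clique_minor_def by (intro exI[of _ "\<lambda>i. f ` B i"]) blast
qed

section \<open>Translation between arc sets and library graphs\<close>

lemma connected_induce_iff_linked:
  assumes "sym (parcs G)"
  shows "Digraph_Component.connected (with_proj G \<restriction> X) \<longleftrightarrow> linked (parcs G) X"
proof -
  let ?R = "parcs G \<inter> X \<times> X"
  \<comment> \<open>A symmetric arc set is its own symmetrisation, so the library's connectivity
    reduces to reachability along arcs inside \<open>X\<close>.\<close>
  have arcs: "parcs (mk_symmetric (with_proj G \<restriction> X)) = ?R"
    using assms by (auto simp: mk_symmetric_def induce_subgraph_def dest: symD)
  have verts: "pverts (mk_symmetric (with_proj G \<restriction> X)) = X"
    by (simp add: mk_symmetric_def)
  have "(x, y) \<in> rtrancl_on X ?R \<longleftrightarrow> (x, y) \<in> ?R\<^sup>*" if "x \<in> X" "y \<in> X" for x y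
    using rtrancl_consistent_rtrancl_on[of x y ?R X] rtrancl_on_rtranclI[of x y X ?R] that by blast
  then show ?thesis
    unfolding Digraph_Component.connected_def strongly_connected_def reachable_def linked_def
    by (simp add: arcs verts)
qed

lemma minor_of_complete_graph_iff:
  assumes "sym (parcs G)"
  shows "has_complete_minor t G \<longleftrightarrow> clique_minor (parcs G) t (pverts G)"
proof
  assume "has_complete_minor t G"
  then obtain B where B: "\<forall>i<t. B i \<subseteq> pverts G \<and> linked (parcs G) (B i)" "disjoint_family_on B {..<t}"
      "\<forall>(i, j)\<in>{(u, v). u < t \<and> v < t \<and> u \<noteq> v}. \<exists>x\<in>B i. \<exists>y\<in>B j. (x, y) \<in> parcs G"
    unfolding has_complete_minor_def minor_of_def
    by (auto simp: connected_induce_iff_linked[OF assms] complete_graph_def)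
  have "\<exists>x\<in>B i. \<exists>y\<in>B j. (x, y) \<in> parcs G" if "i < t" "j < i" for i j
    using B(3) that by auto
  with B(1,2) show "clique_minor (parcs G) t (pverts G)"
    unfolding clique_minor_def by blast
next
  assume "clique_minor (parcs G) t (pverts G)"
  then obtain B where B: "\<forall>i<t. B i \<subseteq> pverts G \<and> linked (parcs G) (B i)" "disjoint_family_on B {..<t}"
      "\<forall>i<t. \<forall>j<i. \<exists>x\<in>B i. \<exists>y\<in>B j. (x, y) \<in> parcs G"
    unfolding clique_minor_def by blast
  have "\<exists>x\<in>B i. \<exists>y\<in>B j. (x, y) \<in> parcs G" if "i < t" "j < t" "i \<noteq> j" for i j
    using B(3) that assms by (metis nat_neq_iff symD)
  with B show "has_complete_minor t G"
    unfolding has_complete_minor_def minor_of_def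
    by (intro exI[of _ B]) (auto simp: connected_induce_iff_linked[OF assms] complete_graph_def)
qed

lemma simple_graphD:
  assumes "simple_graph G"
  shows "finite (pverts G)" "pverts G \<noteq> {}" "parcs G \<subseteq> pverts G \<times> pverts G" "sym (parcs G)"
    "irrefl (parcs G)"
proof -
  from assms have ne: "pverts G \<noteq> {}" and "pair_graph G" by (auto simp: simple_graph_def)
  then interpret pair_graph G by simp
  show "finite (pverts G)" by simp
  show "parcs G \<subseteq> pverts G \<times> pverts G" using in_arcsD1 in_arcsD2 by auto
  show "sym (parcs G)" using pair_sym_arcs by (simp add: symmetric_def)
  show "irrefl (parcs G)" using pair_no_loops by (force simp: irrefl_def)
  show "pverts G \<noteq> {}" by (rule ne)
qed

lemma simple_graphI:
  assumes "finite V" "V \<noteq> {}" "E \<subseteq> V \<times> V" "sym E" "irrefl E"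
  shows "simple_graph \<lparr>pverts = V, parcs = E\<rparr>"
proof -
  have "finite E" using assms(1,3) finite_subset by blast
  with assms show ?thesis
    unfolding simple_graph_def
    by (auto intro!: pair_graph.intro pair_digraph.intro pair_pseudo_graph.intro pair_sym_digraph.intro
      pair_fin_digraph.intro pair_wf_digraph.intro pair_loopfree_digraph.intro
      pair_fin_digraph_axioms.intro pair_sym_digraph_axioms.intro pair_loopfree_digraph_axioms.intro
      simp: symmetric_def irrefl_def)
qed

text \<open>Each edge is the image of exactly two arcs, which are distinct in the absence of loops;
  the arc set is the disjoint union of these fibres.\<close>

lemma card_edge_set:
  assumes "finite (parcs G)" "sym (parcs G)" "irrefl (parcs G)"
  shows "2 * card (edge_set G) = card (parcs G)"
proof -
  let ?F = "\<lambda>e. {(u, v). e = {u, v} \<and> (u, v) \<in> parcs G}"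
  have "card (?F e) = 2" if e: "e \<in> edge_set G" for e
  proof -
    from e obtain u v where uv: "e = {u, v}" "(u, v) \<in> parcs G" by (auto simp: edge_set_def)
    with assms have "?F e = {(u, v), (v, u)}" by (auto simp: doubleton_eq_iff dest: symD)
    moreover have "u \<noteq> v" using uv assms(3) by (auto simp: irrefl_def)
    ultimately show ?thesis by simp
  qed
  moreover have "parcs G = (\<Union>e\<in>edge_set G. ?F e)" by (auto simp: edge_set_def)
  moreover have "edge_set G = (\<lambda>(u, v). {u, v}) ` parcs G" by (auto simp: edge_set_def)
  then have "finite (edge_set G)" using assms(1) by simp
  moreover have "finite (?F e)" for e
    using assms(1) by (rule finite_subset[rotated]) auto
  moreover have "?F e \<inter> ?F e' = {}" if "e \<noteq> e'" for e e' using that by auto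
  ultimately show ?thesis
    using card_UN_disjoint[of "edge_set G" ?F] by simp
qed

text \<open>Counting arcs absorbs the factor 2. From here on density means arcs per vertex.\<close>

lemma avg_degree_eq:
  assumes "simple_graph G"
  shows "avg_degree G = real (card (parcs G)) / real (card (pverts G))"
proof -
  note G = simple_graphD[OF assms]
  have "finite (parcs G)" using G(1,3) finite_subset by blast
  then have "2 * real (card (edge_set G)) = real (card (parcs G))"
    using card_edge_set[OF _ G(4,5)] by (metis of_nat_mult of_nat_numeral)
  then show ?thesis by (simp add: avg_degree_def)
qed

text \<open>An injection into the naturals relabels the graph, the forcing property applies there,
  and the inverse relabelling carries the minor back to an arbitrary vertex type.\<close>

lemma forces_complete_minorD:
  fixes E :: "('a \<times> 'a) set"
  assumes c: "forces_complete_minor t c"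
    and V: "finite V" "V \<noteq> {}" "E \<subseteq> V \<times> V" "sym E" "irrefl E"
    and dense: "real (card E) \<ge> c * real (card V)"
  shows "clique_minor E t V"
proof -
  obtain f :: "'a \<Rightarrow> nat" where f: "inj_on f V"
    using finite_imp_inj_to_nat_seg[OF V(1)] by auto
  let ?E = "map_prod f f ` E"
  have inj: "inj_on (map_prod f f) E"
    using map_prod_inj_on[OF f f] V(3) by (rule inj_on_subset)
  define G where "G = \<lparr>pverts = f ` V, parcs = ?E\<rparr>"
  have "irrefl ?E"
    using V(3,5) f by (fastforce simp: irrefl_def inj_on_def)
  moreover have "sym ?E"
    using V(4) by (force simp: sym_def)
  ultimately have G: "simple_graph G"
    using V unfolding G_def by (intro simple_graphI) auto
  have "card (f ` V) > 0" using V by (simp add: card_gt_0_iff)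
  then have "avg_degree G \<ge> c"
    using dense unfolding avg_degree_eq[OF G]
    by (simp add: G_def card_image[OF inj] card_image[OF f] field_simps)
  with c G have "has_complete_minor t G"
    by (auto simp: forces_complete_minor_def)
  then have "clique_minor ?E t (f ` V)"
    using minor_of_complete_graph_iff[of G t] \<open>sym ?E\<close> by (simp add: G_def)
  then have "clique_minor (map_prod (inv_into V f) (inv_into V f) ` ?E) t (inv_into V f ` f ` V)"
    by (rule clique_minor_image) (use V(3) in \<open>auto intro!: inj_on_inv_into\<close>)
  moreover have "inv_into V f ` f ` V = V"
    using f by (simp add: image_inv_into_cancel)
  moreover have "map_prod (inv_into V f) (inv_into V f) ` ?E = (\<lambda>x. x) ` E"
    using V(3) f unfolding image_image by (intro image_cong) auto
  ultimately show ?thesis by (metis image_ident)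
qed

section \<open>Large average degree forces a clique minor\<close>

text \<open>The arcs at \<open>y\<close> are those leaving and those entering; by symmetry there are
  equally many, and without loops no arc is both.\<close>

lemma card_arcs_remove_vertex:
  assumes "finite U" "y \<in> U" "sym E" "irrefl E"
  shows "card (E \<inter> U \<times> U) = card (E \<inter> (U - {y}) \<times> (U - {y})) + 2 * card (E `` {y} \<inter> U)"
proof -
  let ?D = "E `` {y} \<inter> U" and ?A = "E \<inter> (U - {y}) \<times> (U - {y})"
  have "y \<notin> ?D" using assms(4) by (auto simp: irrefl_def)
  moreover have "E \<inter> U \<times> U = ?A \<union> ({y} \<times> ?D \<union> ?D \<times> {y})"
    using assms(2-4) by (auto dest: symD)
  moreover have "finite ?D" "finite ?A" using assms(1) by (auto intro: finite_subset)
  moreover have "?A \<inter> ({y} \<times> ?D \<union> ?D \<times> {y}) = {}" by auto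
  moreover have "{y} \<times> ?D \<inter> ?D \<times> {y} = {}" using \<open>y \<notin> ?D\<close> by auto
  ultimately show ?thesis
    by (simp add: card_Un_disjoint card_cartesian_product)
qed

text \<open>A contraction argument. In the step to \<open>Suc t\<close>, a connected set
  \<open>X\<close> is contracted, as large as possible while \<open>2 ^ t\<close> edges per vertex
  remain. Every neighbour of \<open>X\<close> then has at least \<open>2 ^ t\<close> neighbours
  among the other neighbours of \<open>X\<close>. So the neighbourhood contains a minor with
  \<open>t\<close> branch sets, and \<open>X\<close> is adjacent to all of them.\<close>

lemma clique_minor_of_dense:
  assumes "sym E" "irrefl E"
  shows "finite V \<Longrightarrow> V \<noteq> {} \<Longrightarrow> card (E \<inter> V \<times> V) \<ge> 2 ^ t * card V \<Longrightarrow> clique_minor E t V"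
proof (induction t arbitrary: V)
  case 0
  then show ?case by (auto simp: clique_minor_def disjoint_family_on_def)
next
  case (Suc t)
  note outer = Suc.IH
  define d :: nat where "d = 2 ^ t"
  have d: "d > 0" by (simp add: d_def)
  show ?case
    using Suc.prems
  proof (induction "card V" arbitrary: V rule: less_induct)
    case less
    define a where "a U = card (E \<inter> U \<times> U)" for U
    define N where "N X = E `` X \<inter> V - X" for X
    \<comment> \<open>The graph obtained from \<open>V\<close> by contracting \<open>X\<close> still has at least \<open>d\<close> edges per vertex.\<close>
    define \<Phi> where "\<Phi> X \<longleftrightarrow> X \<subseteq> V \<and> linked E X \<and>
      2 * d * (card V + 1) \<le> a (V - X) + 2 * card (N X) + 2 * d * card X" for X
    note fin = less.prems(1)
    obtain x where x: "x \<in> V" using less.prems(2) by blast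
    \<comment> \<open>Contracting a single vertex changes nothing, so the assumed density yields
      \<open>\<Phi> {x}\<close>.\<close>
    have "N {x} = E `` {x} \<inter> V" using assms(2) by (auto simp: N_def irrefl_def)
    then have "a V = a (V - {x}) + 2 * card (N {x})"
      using card_arcs_remove_vertex[OF fin x assms] by (simp add: a_def)
    moreover have "2 * d * card V \<le> a V"
      using less.prems(3) by (simp add: a_def d_def)
    ultimately have "2 * d * (card V + 1) \<le> a (V - {x}) + 2 * card (N {x}) + 2 * d * card {x}"
      by (simp add: distrib_left)
    then have "\<Phi> {x}"
      using x by (simp add: \<Phi>_def)
    moreover have "\<forall>X. \<Phi> X \<longrightarrow> card X < Suc (card V)"
      using fin by (auto simp: \<Phi>_def less_Suc_eq_le intro: card_mono)
    ultimately have "\<exists>X. \<Phi> X \<and> (\<forall>Y. \<Phi> Y \<longrightarrow> card Y \<le> card X)"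
      by (rule ex_has_greatest_nat)
    then obtain X where X: "\<Phi> X" and max: "\<And>Y. \<Phi> Y \<Longrightarrow> card Y \<le> card X"
      by blast
    have XV: "X \<subseteq> V" and lX: "linked E X"
      and aX: "2 * d * (card V + 1) \<le> a (V - X) + 2 * card (N X) + 2 * d * card X"
      using X by (auto simp: \<Phi>_def)
    have finX: "finite X" using XV fin finite_subset by blast
    have cV: "card V = card (V - X) + card X"
      using XV finX fin by (simp add: card_Diff_subset card_mono)
    show ?case
    proof (cases "N X = {}")
      \<comment> \<open>The contracted vertex is isolated, so \<open>V - X\<close> alone is dense
        enough, and it has fewer vertices.\<close>
      case True
      then have "2 * d * card (V - X) + 2 * d \<le> a (V - X)"
        using aX cV by (simp add: algebra_simps)
      moreover from this d have "V - X \<noteq> {}" by (cases "V - X = {}") (simp_all add: a_def)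
      moreover have "card (V - X) < card V"
        using lX finX cV by (simp add: linked_def card_gt_0_iff)
      ultimately have "clique_minor E (Suc t) (V - X)"
        using fin by (intro less.hyps) (auto simp: a_def d_def)
      then show ?thesis by (rule clique_minor_mono) auto
    next
      case False
      have finN: "finite (N X)" using fin by (simp add: N_def)
      \<comment> \<open>Absorbing \<open>y\<close> into \<open>X\<close> costs one edge for
        \<open>y\<close> itself and one for each common neighbour of \<open>y\<close> and
        \<open>X\<close>. By maximality more than \<open>d\<close> edges are lost, so there are at
        least \<open>d\<close> common neighbours.\<close>
      have deg: "d \<le> card (E `` {y} \<inter> N X)" if y: "y \<in> N X" for y
      proof -
        let ?D = "E `` {y} \<inter> (V - X)"
        from y obtain x where x: "x \<in> X" "(x, y) \<in> E" "y \<in> V" "y \<notin> X" by (auto simp: N_def)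
        have "linked E (insert y X)" using linked_insert[OF lX x(1,2) assms(1)] .
        moreover have "card (insert y X) = Suc (card X)" using x finX by simp
        ultimately have "\<not> 2 * d * (card V + 1) \<le>
            a (V - insert y X) + 2 * card (N (insert y X)) + 2 * d * Suc (card X)"
          using max[of "insert y X"] x XV by (auto simp: \<Phi>_def)
        moreover have "a (V - X) = a (V - insert y X) + 2 * card ?D"
        proof -
          have "V - X - {y} = V - insert y X" by blast
          then show ?thesis
            using card_arcs_remove_vertex[of "V - X" y E] x fin assms by (simp add: a_def)
        qed
        moreover have "card (N (insert y X)) + 1 + card (E `` {y} \<inter> N X) = card (N X) + card ?D"
        proof -
          have "y \<notin> E `` {y}" using assms(2) by (auto simp: irrefl_def)
          then have "N (insert y X) = (N X - {y}) \<union> (?D - N X)" by (auto simp: N_def)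
          moreover have "card ((N X - {y}) \<union> (?D - N X)) = card (N X - {y}) + card (?D - N X)"
            using fin finN by (intro card_Un_disjoint) auto
          moreover have "card (N X - {y}) + 1 = card (N X)"
            using finN y by (metis Suc_eq_plus1 card_Suc_Diff1)
          moreover have "card ?D = card (?D - N X) + card (?D \<inter> N X)"
            using fin card_Int_Diff[of ?D "N X"] by simp
          moreover have "?D \<inter> N X = E `` {y} \<inter> N X" by (auto simp: N_def)
          ultimately show ?thesis by simp
        qed
        ultimately show ?thesis using aX by (simp add: algebra_simps)
      qed
      have "E \<inter> N X \<times> N X = Sigma (N X) (\<lambda>y. E `` {y} \<inter> N X)" by auto
      then have "card (E \<inter> N X \<times> N X) = (\<Sum>y\<in>N X. card (E `` {y} \<inter> N X))"
        using finN by simp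
      also have "\<dots> \<ge> card (N X) * d"
        using deg sum_bounded_below[of "N X" d] by (simp add: mult.commute)
      finally have "clique_minor E t (N X)"
        using False finN by (intro outer) (simp_all add: d_def mult.commute)
      then obtain B where B: "\<forall>i<t. B i \<subseteq> N X \<and> linked E (B i)" "disjoint_family_on B {..<t}"
          "\<forall>i<t. \<forall>j<i. \<exists>x\<in>B i. \<exists>y\<in>B j. (x, y) \<in> E"
        unfolding clique_minor_def by blast
      define B' where "B' = B(t := X)"
      have "B' i \<subseteq> V \<and> linked E (B' i)" if "i < Suc t" for i
        using B(1) that XV lX by (auto simp: B'_def N_def less_Suc_eq)
      moreover have "disjoint_family_on B' {..<Suc t}"
      proof -
        have "B i \<inter> X = {}" if "i < t" for i using B(1) that by (auto simp: N_def)
        then have "B' i \<inter> B' j = {}" if "i < Suc t" "j < Suc t" "i \<noteq> j" for i j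
          using B(2) that by (cases "i = t"; cases "j = t")
            (simp_all add: B'_def disjoint_family_on_def less_Suc_eq Int_commute)
        then show ?thesis by (auto simp: disjoint_family_on_def simp del: disjoint_iff)
      qed
      moreover have "\<exists>x\<in>B' i. \<exists>y\<in>B' j. (x, y) \<in> E" if ij: "i < Suc t" "j < i" for i j
      proof (cases "i = t")
        case True
        have "B j \<subseteq> N X" "B j \<noteq> {}" using B(1) ij by (auto simp: linked_def)
        then obtain y x where "y \<in> B j" "x \<in> X" "(x, y) \<in> E" by (force simp: N_def)
        then show ?thesis using True ij by (auto simp: B'_def)
      next
        case False
        then show ?thesis using B(3) ij by (auto simp: B'_def)
      qed
      ultimately show ?thesis
        unfolding clique_minor_def by blast
    qed
  qed
qed

text \<open>Makes the set of admissible thresholds nonempty, so that its infimum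
  \<open>minor_threshold\<close> can be approached from above.\<close>

lemma forces_complete_minor_power: "forces_complete_minor t (2 ^ t)"
  unfolding forces_complete_minor_def
proof (intro allI impI)
  fix G :: "nat pair_pre_digraph"
  assume G: "simple_graph G" and dense: "2 ^ t \<le> avg_degree G"
  note G' = simple_graphD[OF G]
  have "card (pverts G) > 0" using G' by (simp add: card_gt_0_iff)
  then have "real (2 ^ t * card (pverts G)) \<le> real (card (parcs G))"
    using dense unfolding avg_degree_eq[OF G] by (simp add: field_simps)
  then have "2 ^ t * card (pverts G) \<le> card (parcs G \<inter> pverts G \<times> pverts G)"
    using G'(3) by (simp only: of_nat_le_iff Int_absorb2)
  from clique_minor_of_dense[OF G'(4,5,1,2) this]
  show "has_complete_minor t G"
    using G'(4) by (simp add: minor_of_complete_graph_iff)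
qed

section \<open>Balls, units and links\<close>

text \<open>The ball of radius \<open>l\<close> around \<open>S\<close> after deletion of
  \<open>W\<close>, except that vertices of \<open>S\<close> are kept even where they lie in
  \<open>W\<close>.\<close>

primrec grow :: "('a \<times> 'a) set \<Rightarrow> 'a set \<Rightarrow> 'a set \<Rightarrow> nat \<Rightarrow> 'a set" where
  "grow E W S 0 = S"
| "grow E W S (Suc l) = grow E W S l \<union> (E `` grow E W S l - W)"

lemma grow_subset:
  assumes "S \<subseteq> V" "E \<subseteq> V \<times> V"
  shows "grow E W S l \<subseteq> V"
  using assms by (induction l) auto

lemma grow_incr: "grow E W S l \<subseteq> grow E W S (Suc l)"
  by auto

lemma subset_grow: "S \<subseteq> grow E W S l"
  by (induction l) auto

lemma grow_avoids: "x \<in> grow E W S l \<Longrightarrow> x \<in> S \<or> x \<notin> W"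
  by (induction l) auto

lemma grow_UN_singletons: "grow E W S l = (\<Union>v\<in>S. grow E W {v} l)"
  by (induction l) auto

text \<open>A radius bound that counts vertices, so a ball of radius \<open>l\<close> around one
  vertex satisfies it with \<open>Suc l\<close>. Connected sets stand in for paths, as only
  connectivity and size matter.\<close>

definition rooted :: "('a \<times> 'a) set \<Rightarrow> nat \<Rightarrow> 'a \<Rightarrow> 'a set \<Rightarrow> bool" where
  "rooted E r v A \<longleftrightarrow> (\<forall>x\<in>A. \<exists>P\<subseteq>A. linked E P \<and> v \<in> P \<and> x \<in> P \<and> finite P \<and> card P \<le> r)"

lemma rooted_mono: "rooted E r v A \<Longrightarrow> r \<le> r' \<Longrightarrow> rooted E r' v A"
  unfolding rooted_def by (meson order_trans)

text \<open>A new vertex is reached by adding it to the set that reaches one of its neighbours. Only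
  part of the next layer need be added, which allows a ball to be cut to an exact size.\<close>

lemma rooted_grow_between:
  assumes "sym E" "rooted E r v A" "A \<subseteq> A'" "A' \<subseteq> A \<union> E `` A"
  shows "rooted E (Suc r) v A'"
  unfolding rooted_def
proof
  fix x assume x: "x \<in> A'"
  show "\<exists>P\<subseteq>A'. linked E P \<and> v \<in> P \<and> x \<in> P \<and> finite P \<and> card P \<le> Suc r"
  proof (cases "x \<in> A")
    case True
    with assms(2,3) show ?thesis unfolding rooted_def by (meson le_SucI order_trans)
  next
    case False
    with x assms(4) obtain y where y: "y \<in> A" "(y, x) \<in> E" by blast
    with assms(2) obtain P where P: "P \<subseteq> A" "linked E P" "v \<in> P" "y \<in> P" "finite P" "card P \<le> r"
      unfolding rooted_def by meson
    have "linked E (insert x P)" using linked_insert[OF P(2,4) y(2) assms(1)] .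
    moreover have "card (insert x P) \<le> Suc r" using P(5,6) by (simp add: card_insert_if)
    ultimately show ?thesis using P assms(3) x
      by (intro exI[of _ "insert x P"]) auto
  qed
qed

lemma rooted_grow:
  assumes "sym E"
  shows "rooted E (Suc l) v (grow E W {v} l)"
proof (induction l)
  case 0
  then show ?case by (auto simp: rooted_def intro!: exI[of _ "{v}"])
next
  case (Suc l)
  then show ?case by (rule rooted_grow_between[OF assms]) auto
qed

definition unit_set :: "('a \<times> 'a) set \<Rightarrow> nat \<Rightarrow> nat \<Rightarrow> 'a set \<Rightarrow> bool" where
  "unit_set E r M A \<longleftrightarrow> finite A \<and> card A = M \<and> (\<exists>v\<in>A. rooted E (Suc r) v A)"

text \<open>In the first ball with at least \<open>M\<close> vertices, part of the last layer is
  dropped until exactly \<open>M\<close> remain. The preceding ball stays whole, so the radius bound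
  survives.\<close>

lemma unit_set_of_grow:
  assumes "sym E" "finite (grow E W {v} r)" "M \<le> card (grow E W {v} r)" "M > 0" "v \<notin> W"
  shows "\<exists>A. unit_set E r M A \<and> A \<inter> W = {} \<and> A \<subseteq> grow E W {v} r"
  using assms(2,3)
proof (induction r)
  case 0
  then have "M = 1" using assms(4) by simp
  then show ?case
    using assms(5) by (intro exI[of _ "{v}"]) (auto simp: unit_set_def rooted_def)
next
  case (Suc r)
  let ?G = "grow E W {v}"
  have fin: "finite (?G r)" using Suc.prems(1) by simp
  show ?case
  proof (cases "M \<le> card (?G r)")
    case True
    from Suc.IH[OF fin this] obtain A where "unit_set E r M A" "A \<inter> W = {}" "A \<subseteq> ?G r" by blast
    moreover from this(1) have "unit_set E (Suc r) M A"
      unfolding unit_set_def using rooted_mono[of E "Suc r" _ A "Suc (Suc r)"] by auto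
    ultimately show ?thesis using grow_incr[of E W "{v}" r] by blast
  next
    case False
    then obtain A where A: "?G r \<subseteq> A" "A \<subseteq> ?G (Suc r)" "card A = M"
      using exists_subset_between[of "?G r" M "?G (Suc r)"] Suc.prems by auto
    have "rooted E (Suc (Suc r)) v A"
      using A(1,2) by (intro rooted_grow_between[OF assms(1) rooted_grow[OF assms(1)]]) auto
    moreover have "v \<in> A" using A(1) subset_grow[of "{v}" E W r] by auto
    moreover have "finite A" using A(2) Suc.prems(1) by (rule finite_subset)
    moreover have "A \<inter> W = {}"
      using A(2) grow_avoids[of _ E W "{v}" "Suc r"] assms(5) by blast
    ultimately show ?thesis using A by (auto simp: unit_set_def)
  qed
qed

section \<open>Links between disjoint sets\<close>

text \<open>
  \<open>P\<close> consists of the inner vertices of a connection from \<open>A\<close> to \<open>B\<close>.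
\<close>

definition link :: "('a \<times> 'a) set \<Rightarrow> 'a set \<Rightarrow> 'a set \<Rightarrow> 'a set \<Rightarrow> bool" where
  "link E A B P \<longleftrightarrow> P \<inter> (A \<union> B) = {} \<and>
     (\<exists>a\<in>A. \<exists>b\<in>B. \<exists>p\<in>insert a P. linked E (insert a P) \<and> (p, b) \<in> E)"

text \<open>Walk from \<open>y\<close> towards \<open>B\<close>, one radius less at each step. If
  the walk returns to \<open>A\<close>, the part walked so far is discarded and the path restarts
  there, which keeps the inner vertices off \<open>A\<close>.\<close>

lemma link_of_path_to_grow:
  assumes "sym E" "A \<inter> B = {}"
    and "a \<in> A" "linked E (insert a P)" "y \<in> insert a P" "P \<inter> (A \<union> B \<union> W) = {}" "finite P"
    and "y \<in> grow E W B l"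
  shows "\<exists>P'. link E A B P' \<and> P' \<inter> W = {} \<and> finite P' \<and> card P' \<le> card P + l"
  using assms(3-)
proof (induction l arbitrary: a P y)
  case 0
  then show ?case using assms(2) by auto
next
  case (Suc l)
  show ?case
  proof (cases "y \<in> grow E W B l")
    case True
    from Suc.IH[OF Suc.prems(1-5) this] obtain P' where
      "link E A B P'" "P' \<inter> W = {}" "finite P'" "card P' \<le> card P + l" by blast
    then show ?thesis by (intro exI[of _ P']) auto
  next
    case False
    with Suc.prems(6) obtain z where z: "z \<in> grow E W B l" "(y, z) \<in> E"
      using assms(1) by (auto dest: symD)
    consider "z \<in> B" | "z \<in> A" | "z \<notin> A" "z \<notin> B" by blast
    then show ?thesis
    proof cases
      case 1
      with Suc.prems z have "link E A B P" unfolding link_def by blast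
      then show ?thesis using Suc.prems by (intro exI[of _ P]) auto
    next
      case 2
      from Suc.IH[of z "{}" z] 2 z obtain P' where
        "link E A B P'" "P' \<inter> W = {}" "finite P'" "card P' \<le> l" by auto
      then show ?thesis by (intro exI[of _ P']) auto
    next
      case 3
      have "z \<notin> W" using grow_avoids[OF z(1)] 3 by blast
      have "linked E (insert z (insert a P))"
        using linked_insert[OF Suc.prems(2,3) z(2) assms(1)] .
      then have "\<exists>P'. link E A B P' \<and> P' \<inter> W = {} \<and> finite P' \<and> card P' \<le> card (insert z P) + l"
        using Suc.prems(1,4,5) 3 \<open>z \<notin> W\<close> z(1)
        by (intro Suc.IH[of a "insert z P" z]) (auto simp: insert_commute)
      then obtain P' where "link E A B P'" "P' \<inter> W = {}" "finite P'" "card P' \<le> card (insert z P) + l"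
        by blast
      moreover have "card (insert z P) \<le> Suc (card P)"
        using Suc.prems(5) by (simp add: card_insert_if)
      ultimately show ?thesis by (intro exI[of _ P']) auto
    qed
  qed
qed

text \<open>Follow a walk from \<open>A\<close> to \<open>y\<close>, restarting at each return to
  \<open>A\<close>. Either it reaches \<open>B\<close>, which is already a link, or all vertices
  after its start avoid both sets.\<close>

lemma path_of_grow:
  assumes "sym E" "y \<in> grow E W A l"
  shows "(\<exists>P. link E A B P \<and> P \<inter> W = {} \<and> finite P \<and> card P \<le> l) \<or>
    (\<exists>a\<in>A. \<exists>P. linked E (insert a P) \<and> y \<in> insert a P \<and> P \<inter> (A \<union> B \<union> W) = {} \<and> finite P \<and> card P \<le> l)"
    (is "?link l \<or> ?path y l")
  using assms(2)
proof (induction l arbitrary: y)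
  case 0
  then have "?path y 0" by (intro bexI[of _ y] exI[of _ "{}"]) auto
  then show ?case ..
next
  case (Suc l)
  show ?case
  proof (cases "y \<in> grow E W A l")
    case True
    from Suc.IH[OF this] show ?thesis by (meson le_SucI)
  next
    case False
    with Suc.prems obtain z where z: "z \<in> grow E W A l" "(z, y) \<in> E" "y \<notin> W" by auto
    from Suc.IH[OF z(1)] consider "?link l" | "?path z l" by blast
    then show ?thesis
    proof cases
      case 1
      then show ?thesis by (meson le_SucI)
    next
      case 2
      then obtain a P where P: "a \<in> A" "linked E (insert a P)" "z \<in> insert a P"
        "P \<inter> (A \<union> B \<union> W) = {}" "finite P" "card P \<le> l" by blast
      consider "y \<in> B" | "y \<in> A" | "y \<notin> A" "y \<notin> B" by blast
      then show ?thesis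
      proof cases
        case 1
        with P z have "link E A B P" unfolding link_def by blast
        then have "?link (Suc l)" using P by (intro exI[of _ P]) auto
        then show ?thesis ..
      next
        case 2
        then have "?path y (Suc l)" by (intro bexI[of _ y] exI[of _ "{}"]) auto
        then show ?thesis ..
      next
        case 3
        have "linked E (insert y (insert a P))" using linked_insert[OF P(2,3) z(2) assms(1)] .
        then have "?path y (Suc l)"
          using P 3 z(3)
          by (intro bexI[of _ a] exI[of _ "insert y P"]) (auto simp: insert_commute card_insert_if)
        then show ?thesis ..
      qed
    qed
  qed
qed

text \<open>The walk from \<open>A\<close> to the common vertex \<open>y\<close> is prolonged by a
  walk from \<open>y\<close> to \<open>B\<close>; each contributes at most \<open>l\<close> inner
  vertices.\<close>

lemma link_of_grow_meet:
  assumes "sym E" "A \<inter> B = {}" "y \<in> grow E W A l" "y \<in> grow E W B l"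
  shows "\<exists>P. link E A B P \<and> P \<inter> W = {} \<and> finite P \<and> card P \<le> 2 * l"
  using path_of_grow[OF assms(1,3), of B]
proof (elim disjE exE bexE conjE)
  fix P assume "link E A B P" "P \<inter> W = {}" "finite P" "card P \<le> l"
  then show ?thesis by (intro exI[of _ P]) auto
next
  fix a P
  assume P: "a \<in> A" "linked E (insert a P)" "y \<in> insert a P" "P \<inter> (A \<union> B \<union> W) = {}" "finite P"
    "card P \<le> l"
  from link_of_path_to_grow[OF assms(1,2) P(1-5) assms(4)] obtain P' where
    "link E A B P'" "P' \<inter> W = {}" "finite P'" "card P' \<le> card P + l" by blast
  with P(6) show ?thesis by (intro exI[of _ P']) auto
qed

text \<open>A largest independent set \<open>X\<close> has fewer than \<open>k\<close> elements, and
  every other vertex is adjacent to one of them. So some \<open>x\<close> in \<open>X\<close> has at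
  least \<open>k ^ t\<close> neighbours outside \<open>X\<close>, where the induction continues. For
  fixed \<open>t\<close> the bound is polynomial in \<open>k\<close>, which the choice of parameters
  relies on.\<close>

lemma ramsey_clique:
  fixes R :: "'b \<Rightarrow> 'b \<Rightarrow> bool"
  assumes "k > 0"
    and indep: "\<And>X. X \<subseteq> V \<Longrightarrow> finite X \<Longrightarrow> card X = k \<Longrightarrow> \<exists>x\<in>X. \<exists>y\<in>X. x \<noteq> y \<and> (R x y \<or> R y x)"
    and "finite V" "card V \<ge> k ^ t"
  shows "\<exists>Y\<subseteq>V. finite Y \<and> card Y = t \<and> (\<forall>x\<in>Y. \<forall>y\<in>Y. x \<noteq> y \<longrightarrow> R x y \<or> R y x)"
  using assms(2-)
proof (induction t arbitrary: V)
  case 0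
  then show ?case by (intro exI[of _ "{}"]) auto
next
  case (Suc t)
  define S where "S x y \<longleftrightarrow> R x y \<or> R y x" for x y
  define ind where "ind X \<longleftrightarrow> X \<subseteq> V \<and> (\<forall>x\<in>X. \<forall>y\<in>X. x \<noteq> y \<longrightarrow> \<not> S x y)" for X
  have "\<exists>X. ind X \<and> (\<forall>Y. ind Y \<longrightarrow> card Y \<le> card X)"
    by (rule ex_has_greatest_nat[of ind "{}" _ "Suc (card V)"])
       (auto simp: ind_def less_Suc_eq_le intro: card_mono Suc.prems(2))
  then obtain X where X: "ind X" and max: "\<And>Y. ind Y \<Longrightarrow> card Y \<le> card X" by blast
  have XV: "X \<subseteq> V" and finX: "finite X"
    using X Suc.prems(2) by (auto simp: ind_def intro: finite_subset)
  have cX: "card X < k"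
  proof (rule ccontr)
    assume "\<not> card X < k"
    then obtain X' where "X' \<subseteq> X" "card X' = k" "finite X'"
      by (meson not_less obtain_subset_with_card_n)
    with Suc.prems(1)[of X'] X show False unfolding ind_def S_def by blast
  qed
  define Nb where "Nb x = {y \<in> V - X. S x y}" for x
  have cover: "V - X \<subseteq> (\<Union>x\<in>X. Nb x)"
  proof
    fix y assume y: "y \<in> V - X"
    then have "\<not> ind (insert y X)" using max[of "insert y X"] finX by auto
    with X y show "y \<in> (\<Union>x\<in>X. Nb x)" by (auto simp: ind_def Nb_def S_def)
  qed
  have "\<exists>x\<in>X. card (Nb x) \<ge> k ^ t"
  proof (rule ccontr)
    assume "\<not> ?thesis"
    then have "card (Nb x) < k ^ t" if "x \<in> X" for x using that by (simp add: not_le)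
    then have small: "card (Nb x) \<le> k ^ t - 1" if "x \<in> X" for x using that by fastforce
    have "card (V - X) \<le> card (\<Union>x\<in>X. Nb x)"
      using cover Suc.prems(2) finX by (intro card_mono) (auto simp: Nb_def)
    also have "\<dots> \<le> (\<Sum>x\<in>X. card (Nb x))" by (rule card_UN_le[OF finX])
    also have "\<dots> \<le> card X * (k ^ t - 1)" 
      using small sum_bounded_above[of X "\<lambda>x. card (Nb x)" "k ^ t - 1"] by simp
    finally have "card V \<le> card X * (k ^ t - 1) + card X"
      using XV finX Suc.prems(2) by (simp add: card_Diff_subset)
    also have "\<dots> = card X * k ^ t" using \<open>k > 0\<close> by (simp add: right_diff_distrib' le_add_diff_inverse2)
    also have "\<dots> < k ^ Suc t" using cX \<open>k > 0\<close> by simp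
    finally show False using Suc.prems(3) by simp
  qed
  then obtain x where x: "x \<in> X" "card (Nb x) \<ge> k ^ t" by blast
  have "\<exists>Y\<subseteq>Nb x. finite Y \<and> card Y = t \<and> (\<forall>x\<in>Y. \<forall>y\<in>Y. x \<noteq> y \<longrightarrow> R x y \<or> R y x)"
    using Suc.prems(1,2) x(2) by (intro Suc.IH) (auto simp: Nb_def)
  then obtain Y where Y: "Y \<subseteq> Nb x" "finite Y" "card Y = t" "\<forall>x\<in>Y. \<forall>y\<in>Y. x \<noteq> y \<longrightarrow> R x y \<or> R y x"
    by blast
  have "x \<notin> Y" using Y(1) x(1) by (auto simp: Nb_def)
  with Y x XV show ?case
    by (intro exI[of _ "insert x Y"]) (auto simp: Nb_def S_def)
qed

section \<open>Small clique minors in expanders\<close>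

lemma linked_subset:
  assumes "linked E X" "E \<subseteq> V \<times> V" "a \<in> X" "a \<in> V"
  shows "X \<subseteq> V"
proof
  fix x assume "x \<in> X"
  with assms have "(a, x) \<in> (E \<inter> X \<times> X)\<^sup>*" by (auto simp: linked_def)
  then show "x \<in> V" using assms(2,4) by induction auto
qed

section \<open>Selection by first moment and by greedy choice\<close>

text \<open>First moment method over all maps \<open>{..<q} \<rightarrow> U\<close>.\<close>

lemma free_set:
  fixes Z :: "'b \<Rightarrow> 'b \<Rightarrow> 'b set"
  assumes "finite U" and Z: "\<And>a b. finite (Z a b) \<and> card (Z a b) \<le> z"
    and n: "q ^ 3 * (z + 1) < card U"
  shows "\<exists>X\<subseteq>U. card X = q \<and> (\<forall>a\<in>X. \<forall>b\<in>X. \<forall>c\<in>X. c \<noteq> a \<longrightarrow> c \<noteq> b \<longrightarrow> c \<notin> Z a b)"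
proof (cases "q = 0")
  case False
  define F where "F = PiE {..<q} (\<lambda>_. U)"
  \<comment> \<open>\<open>insert (f i)\<close> also makes a coincidence of values bad, so a good
    map is injective; triples with \<open>i = j\<close> are included.\<close>
  define bad where "bad i j c = {f \<in> F. f c \<in> insert (f i) (Z (f i) (f j))}" for i j c
  define T where "T = {(i, j, c). i < q \<and> j < q \<and> c < q \<and> c \<noteq> i \<and> c \<noteq> j}"
  have T: "T \<subseteq> {..<q} \<times> {..<q} \<times> {..<q}" by (auto simp: T_def)
  then have finT: "finite T" by (rule finite_subset) simp
  have cT: "card T \<le> q ^ 3"
    using card_mono[OF _ T] by (simp add: card_cartesian_product power3_eq_cube)
  \<comment> \<open>The forbidden set depends on \<open>f i\<close> and \<open>f j\<close> only, so
    once all values except that at \<open>c\<close> are fixed, at most \<open>z + 1\<close> values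
    at \<open>c\<close> are bad.\<close>
  have cbad: "card (bad i j c) \<le> card U ^ (q - 1) * (z + 1)" if "(i, j, c) \<in> T" for i j c
  proof -
    let ?G = "PiE ({..<q} - {c}) (\<lambda>_. U)" and ?Z = "\<lambda>g. insert (g i) (Z (g i) (g j))"
    have ij: "i < q" "j < q" "c < q" "c \<noteq> i" "c \<noteq> j" using that by (auto simp: T_def)
    have "bad i j c \<subseteq> (\<lambda>(g, x). g(c := x)) ` Sigma ?G ?Z"
    proof
      fix f assume f: "f \<in> bad i j c"
      let ?g = "restrict f ({..<q} - {c})"
      have "?g \<in> ?G" using f by (auto simp: bad_def F_def PiE_def)
      moreover have "f c \<in> ?Z ?g" using f ij by (auto simp: bad_def)
      ultimately have mem: "(?g, f c) \<in> Sigma ?G ?Z" unfolding mem_Sigma_iff by (rule conjI)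
      have "f = (case (?g, f c) of (g, x) \<Rightarrow> g(c := x))"
        using f by (auto simp: bad_def F_def PiE_def extensional_def fun_eq_iff)
      then show "f \<in> (\<lambda>(g, x). g(c := x)) ` Sigma ?G ?Z" using mem by (rule image_eqI)
    qed
    moreover have fin: "finite ?G" using assms(1) by (intro finite_PiE) auto
    moreover have "finite (Sigma ?G ?Z)" using fin Z by (intro finite_SigmaI) auto
    ultimately have "card (bad i j c) \<le> card (Sigma ?G ?Z)"
      using surj_card_le by blast
    also have "\<dots> = (\<Sum>g\<in>?G. card (?Z g))" using fin Z by simp
    also have "\<dots> \<le> (\<Sum>g\<in>?G. z + 1)"
    proof (rule sum_mono)
      fix g
      show "card (?Z g) \<le> z + 1"
        using Z[of "g i" "g j"] card_insert_le_m1[of "z + 1" "Z (g i) (g j)" "g i"] by simp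
    qed
    also have "\<dots> = card U ^ (q - 1) * (z + 1)"
      using ij by (simp add: card_PiE)
    finally show ?thesis .
  qed
  have "card (\<Union>(i, j, c)\<in>T. bad i j c) \<le> (\<Sum>(i, j, c)\<in>T. card (bad i j c))"
    using card_UN_le[OF finT, of "\<lambda>(i, j, c). bad i j c"] by (simp add: case_prod_unfold)
  also have "\<dots> \<le> (\<Sum>e\<in>T. card U ^ (q - 1) * (z + 1))"
    using cbad by (intro sum_mono) auto
  also have "\<dots> \<le> q ^ 3 * (card U ^ (q - 1) * (z + 1))"
    using cT by simp
  also have "\<dots> = (q ^ 3 * (z + 1)) * card U ^ (q - 1)" by (simp only: ac_simps)
  also have "\<dots> < card U * card U ^ (q - 1)"
    using n by (intro mult_strict_right_mono) auto
  also have "\<dots> = card F"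
    using False by (simp add: F_def card_PiE power_eq_if)
  finally have "card (\<Union>(i, j, c)\<in>T. bad i j c) < card F" .
  moreover have "finite F" using assms(1) by (simp add: F_def finite_PiE)
  then have "finite (\<Union>(i, j, c)\<in>T. bad i j c)"
    by (rule finite_subset[rotated]) (auto simp: bad_def)
  ultimately have "\<not> F \<subseteq> (\<Union>(i, j, c)\<in>T. bad i j c)"
    using card_mono[of "\<Union>(i, j, c)\<in>T. bad i j c" F] not_le by blast
  then obtain f where f: "f \<in> F" "\<And>i j c. (i, j, c) \<in> T \<Longrightarrow> f \<notin> bad i j c" by auto
  have neq: "f c \<noteq> f i" if "i < q" "c < q" "c \<noteq> i" for i c
    using f(1) f(2)[of i i c] that by (auto simp: T_def bad_def)
  have free: "f c \<notin> Z (f i) (f j)" if "i < q" "j < q" "c < q" "c \<noteq> i" "c \<noteq> j" for i j c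
    using f(1) f(2)[of i j c] that by (auto simp: T_def bad_def)
  have "inj_on f {..<q}" using neq by (auto simp: inj_on_def)
  then have "card (f ` {..<q}) = q" by (simp add: card_image)
  moreover have "f ` {..<q} \<subseteq> U" using f(1) by (auto simp: F_def)
  ultimately show ?thesis
    using free by (intro exI[of _ "f ` {..<q}"]) auto
qed (auto intro: exI[of _ "{}"])

text \<open>Greedy choice: the union of the sets chosen before has at most \<open>w\<close> elements
  and can serve as the set to avoid.\<close>

lemma disjoint_selection:
  assumes "finite I"
    and ex: "\<And>e W. e \<in> I \<Longrightarrow> finite W \<Longrightarrow> card W \<le> w \<Longrightarrow> \<exists>P. \<phi> e P \<and> P \<inter> W = {} \<and> finite P \<and> card P \<le> R"
    and "card I * R \<le> w"
  shows "\<exists>P. (\<forall>e\<in>I. \<phi> e (P e) \<and> finite (P e) \<and> card (P e) \<le> R) \<and> disjoint_family_on P I"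
  using assms
proof (induction I rule: finite_induct)
  case empty
  then show ?case by (simp add: disjoint_family_on_def)
next
  case (insert e I)
  have "card I * R \<le> w" using insert by simp
  with insert obtain P where P: "\<forall>e\<in>I. \<phi> e (P e) \<and> finite (P e) \<and> card (P e) \<le> R"
      "disjoint_family_on P I" by (metis insertI2)
  let ?W = "\<Union>e\<in>I. P e"
  have "card ?W \<le> (\<Sum>e\<in>I. card (P e))" by (rule card_UN_le[OF insert.hyps(1)])
  also have "\<dots> \<le> card I * R" using P(1) by (intro sum_bounded_above[of I _ R, simplified]) auto
  finally have "card ?W \<le> w" using \<open>card I * R \<le> w\<close> by simp
  moreover have "finite ?W" using P(1) insert.hyps(1) by auto
  ultimately obtain P' where P': "\<phi> e P'" "P' \<inter> ?W = {}" "finite P'" "card P' \<le> R"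
    using insert.prems(1)[of e ?W] by auto
  then show ?case
    using P insert.hyps(2)
    by (intro exI[of _ "P(e := P')"]) (auto simp: disjoint_family_on_def)
qed

text \<open>\<open>\<rho>\<close> is the expansion rate of sets of at most \<open>Q\<close>
  vertices. Half of it is reserved for deleted vertices, and \<open>radius\<close> says that growth
  at the other half reaches \<open>Q\<close> in \<open>r\<close> steps.\<close>

locale expander =
  fixes V :: "'a set" and E :: "('a \<times> 'a) set" and \<rho> Q :: real and r :: nat
  assumes finite_V: "finite V" and E_V: "E \<subseteq> V \<times> V" and sym_E: "sym E" and rho: "0 < \<rho>"
    and expand: "\<And>S. S \<subseteq> V \<Longrightarrow> S \<noteq> {} \<Longrightarrow> card S \<le> Q \<Longrightarrow> \<rho> * card S \<le> card (E `` S - S)"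
    and radius: "Q \<le> (1 + \<rho> / 2) ^ r"
begin

lemma finite_grow: "S \<subseteq> V \<Longrightarrow> finite (grow E W S l)"
  using grow_subset[of S V E W l] E_V finite_V finite_subset by blast

text \<open>While the ball has fewer than \<open>Q\<close> vertices, \<open>W\<close> destroys at
  most half of the guaranteed new neighbours, because the ball is at least as large as
  \<open>S\<close>. So each step multiplies the size by at least
  \<open>1 + \<rho> / 2\<close>.\<close>

lemma grow_large:
  assumes S: "S \<subseteq> V" "S \<noteq> {}" and W: "finite W" "card W \<le> \<rho> / 2 * card S"
  shows "Q \<le> card (grow E W S r)"
proof -
  let ?G = "grow E W S"
  have "Q \<le> card (?G l) \<or> (1 + \<rho> / 2) ^ l \<le> card (?G l)" for l
  proof (induction l)
    case 0
    have "card S > 0" using S finite_V finite_subset by (metis card_gt_0_iff)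
    then show ?case by simp
  next
    case (Suc l)
    let ?D = "E `` ?G l - ?G l"
    have GV: "?G l \<subseteq> V" using grow_subset S(1) E_V by blast
    have fin: "finite (?G l)" "finite ?D" "finite (?G (Suc l))"
      using finite_grow[OF S(1)] GV finite_V E_V by (auto intro: finite_subset[of _ V] simp del: grow.simps)
    have mono: "card (?G l) \<le> card (?G (Suc l))"
      using fin(3) grow_incr by (rule card_mono)
    show ?case
    proof (cases "Q \<le> card (?G l)")
      case True
      with mono show ?thesis by linarith
    next
      case False
      have "S \<subseteq> ?G l" by (rule subset_grow)
      then have cS: "card S \<le> card (?G l)" and ne: "?G l \<noteq> {}"
        using fin(1) S(2) by (auto intro: card_mono)
      have "\<rho> * card (?G l) \<le> card ?D"
        using expand[OF GV ne] False by simp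
      moreover have "card ?D \<le> card (?D - W) + card W"
        using W(1) fin(2) card_Un_le[of "?D - W" W] card_mono[of "(?D - W) \<union> W" ?D] by auto
      moreover have "card (?G (Suc l)) = card (?G l) + card (?D - W)"
      proof -
        have "?G (Suc l) = ?G l \<union> (?D - W)" by auto
        moreover have "card (?G l \<union> (?D - W)) = card (?G l) + card (?D - W)"
          using fin by (intro card_Un_disjoint) auto
        ultimately show ?thesis by (simp only:)
      qed
      moreover have "card W \<le> \<rho> / 2 * card (?G l)"
        using W(2) cS rho by (smt (verit) mult_left_mono half_gt_zero of_nat_mono)
      ultimately have "(1 + \<rho> / 2) * card (?G l) \<le> card (?G (Suc l))"
        by (simp add: algebra_simps del: grow.simps)
      moreover have "(1 + \<rho> / 2) * (1 + \<rho> / 2) ^ l \<le> (1 + \<rho> / 2) * card (?G l)"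
        using Suc.IH False rho by (intro mult_left_mono) auto
      ultimately show ?thesis by (simp del: grow.simps)
    qed
  qed
  from this[of r] radius show ?thesis by linarith
qed

text \<open>A single vertex may be cut off by \<open>W\<close>, but a set \<open>S\<close> of
  \<open>s\<close> vertices grows to at least \<open>Q > s * M\<close> vertices. Its ball is the
  union of the balls of its elements, so one of these has at least \<open>M\<close>
  vertices.\<close>

lemma ex_unit_set_avoiding:
  assumes W: "finite W" "card W \<le> \<rho> / 2 * s" "s + card W \<le> card V" and M: "M > 0" "s > 0" "s * M < Q"
  shows "\<exists>A. unit_set E r M A \<and> A \<inter> W = {} \<and> A \<subseteq> V"
proof -
  have "card V \<le> card (V - W) + card W"
    using card_Un_le[of "V - W" W] card_mono[of "(V - W) \<union> W" V] finite_V W(1) by auto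
  then have "s \<le> card (V - W)" using W(3) by simp
  then obtain S where S: "S \<subseteq> V - W" "card S = s" "finite S"
    by (rule obtain_subset_with_card_n)
  have "\<exists>v\<in>S. M \<le> card (grow E W {v} r)"
  proof (rule ccontr)
    assume "\<not> ?thesis"
    then have small: "card (grow E W {v} r) \<le> M" if "v \<in> S" for v using that by force
    have "card (grow E W S r) \<le> (\<Sum>v\<in>S. card (grow E W {v} r))"
      unfolding grow_UN_singletons[of E W S] by (rule card_UN_le[OF S(3)])
    also have "\<dots> \<le> s * M" using small S(2) sum_bounded_above[of S _ M] by simp
    finally have "real (card (grow E W S r)) \<le> real (s * M)" by (rule of_nat_mono)
    with M(3) have "card (grow E W S r) < Q" by simp
    moreover have "Q \<le> card (grow E W S r)"
      using S M(2) W by (intro grow_large) auto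
    ultimately show False by simp
  qed
  then obtain v where v: "v \<in> S" "M \<le> card (grow E W {v} r)" by blast
  have "{v} \<subseteq> V" "v \<notin> W" using v(1) S(1) by auto
  from unit_set_of_grow[OF sym_E finite_grow[OF this(1)] v(2) M(1) this(2)]
  show ?thesis
    using grow_subset[OF \<open>{v} \<subseteq> V\<close> E_V] by (meson order_trans)
qed

lemma ex_many_unit_sets:
  assumes M: "M > 0" "s > 0" "s * M < Q" and N: "N * M \<le> \<rho> / 2 * s" "s + N * M \<le> card V"
  shows "\<exists>\<U>. finite \<U> \<and> card \<U> = N \<and> disjoint \<U> \<and> (\<forall>A\<in>\<U>. unit_set E r M A \<and> A \<subseteq> V)"
proof -
  have "\<exists>\<U>. finite \<U> \<and> card \<U> = n \<and> disjoint \<U> \<and> (\<forall>A\<in>\<U>. unit_set E r M A \<and> A \<subseteq> V)"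
    if "n \<le> N" for n
    using that
  proof (induction n)
    case 0
    then show ?case by (intro exI[of _ "{}"]) auto
  next
    case (Suc n)
    then obtain \<U> where U: "finite \<U>" "card \<U> = n" "disjoint \<U>"
      "\<forall>A\<in>\<U>. unit_set E r M A \<and> A \<subseteq> V" by auto
    have "card (\<Union>\<U>) \<le> (\<Sum>A\<in>\<U>. card A)"
      using card_UN_le[OF U(1), of "\<lambda>A. A"] by simp
    also have "\<dots> = n * M" using U by (simp add: unit_set_def)
    also have "\<dots> \<le> N * M" using Suc.prems by simp
    finally have c: "card (\<Union>\<U>) \<le> N * M" .
    then have "real (card (\<Union>\<U>)) \<le> N * M" by (rule of_nat_mono)
    then have "card (\<Union>\<U>) \<le> \<rho> / 2 * s" using N(1) unfolding of_nat_mult by linarith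
    moreover have "finite (\<Union>\<U>)" using U by (auto simp: unit_set_def)
    ultimately obtain A where A: "unit_set E r M A" "A \<inter> \<Union>\<U> = {}" "A \<subseteq> V"
      using ex_unit_set_avoiding[of "\<Union>\<U>" s M] M N(2) c by auto
    have "A \<noteq> {}" using A(1) by (auto simp: unit_set_def)
    then have "A \<notin> \<U>" using A(2) by auto
    moreover have "disjoint (insert A \<U>)"
      using U(3) A(2) by (auto simp: disjoint_def)
    ultimately show ?case using A U by (intro exI[of _ "insert A \<U>"]) auto
  qed
  then show ?thesis by blast
qed

section \<open>Robustly linked units\<close>

definition robust :: "nat \<Rightarrow> 'a set \<Rightarrow> 'a set \<Rightarrow> bool" where
  "robust w A B \<longleftrightarrow> (\<forall>W. finite W \<longrightarrow> card W \<le> w \<longrightarrow>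
     (\<exists>P. link E A B P \<and> P \<inter> W = {} \<and> finite P \<and> card P \<le> 2 * r))"

text \<open>Pigeonhole: pairwise disjoint balls with at least \<open>Q\<close> vertices each would
  not fit into \<open>V\<close>.\<close>

lemma ex_meeting_pair:
  assumes X: "finite X" "disjoint X" "\<And>A. A \<in> X \<Longrightarrow> A \<subseteq> V \<and> card A = M" and "M > 0"
    and k: "card V < card X * Q" and W: "finite W" "card W \<le> \<rho> / 2 * M"
  shows "\<exists>A\<in>X. \<exists>B\<in>X. A \<noteq> B \<and> grow E W A r \<inter> grow E W B r \<noteq> {}"
proof (rule ccontr)
  assume neg: "\<not> ?thesis"
  have GV: "grow E W A r \<subseteq> V" if "A \<in> X" for A using X(3)[OF that] grow_subset E_V by blast
  have "card (\<Union>A\<in>X. grow E W A r) = (\<Sum>A\<in>X. card (grow E W A r))"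
    using neg X finite_grow by (intro card_UN_disjoint) auto
  moreover have "card (\<Union>A\<in>X. grow E W A r) \<le> card V"
    using GV by (intro card_mono[OF finite_V]) auto
  moreover have "real (card X) * Q \<le> (\<Sum>A\<in>X. real (card (grow E W A r)))"
  proof (rule sum_bounded_below)
    fix A assume "A \<in> X"
    with X(3) have A: "A \<subseteq> V" "card A = M" by auto
    with \<open>M > 0\<close> have "A \<noteq> {}" by auto
    with A W show "Q \<le> card (grow E W A r)" by (intro grow_large) simp_all
  qed
  ultimately show False using k by (simp flip: of_nat_sum)
qed

text \<open>For every ordered pair that is not robust, delete a set that blocks all its short links.
  The balls of some two members still meet and give links in both directions that avoid the blocking
  sets, so this pair is robust in both directions.\<close>

lemma ex_robust_pair:
  assumes X: "finite X" "disjoint X" "\<And>A. A \<in> X \<Longrightarrow> A \<subseteq> V \<and> card A = M" and "M > 0"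
    and k: "card V < card X * Q" "real (card X ^ 2 * w) \<le> \<rho> / 2 * M"
  shows "\<exists>A\<in>X. \<exists>B\<in>X. A \<noteq> B \<and> robust w A B \<and> robust w B A"
proof (rule ccontr)
  assume neg: "\<not> ?thesis"
  define blocks where "blocks e W \<longleftrightarrow> finite W \<and> card W \<le> w \<and> (\<not> robust w (fst e) (snd e) \<longrightarrow>
    (\<forall>P. link E (fst e) (snd e) P \<longrightarrow> finite P \<longrightarrow> card P \<le> 2 * r \<longrightarrow> P \<inter> W \<noteq> {}))" for e W
  have "\<exists>W. blocks e W" for e
  proof (cases "robust w (fst e) (snd e)")
    case True
    then show ?thesis by (intro exI[of _ "{}"]) (auto simp: blocks_def)
  next
    case False
    then show ?thesis unfolding blocks_def robust_def by blast
  qed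
  then obtain F where F: "\<And>e. blocks e (F e)" by metis
  let ?W = "\<Union>e\<in>X \<times> X. F e"
  have "card ?W \<le> (\<Sum>e\<in>X \<times> X. card (F e))" using X(1) by (intro card_UN_le) auto
  also have "\<dots> \<le> card (X \<times> X) * w"
    using F by (intro sum_bounded_above[of "X \<times> X" _ w, simplified]) (auto simp: blocks_def)
  also have "\<dots> = card X ^ 2 * w" by (simp add: card_cartesian_product power2_eq_square)
  finally have "real (card ?W) \<le> real (card X ^ 2 * w)" by (rule of_nat_mono)
  then have "card ?W \<le> \<rho> / 2 * M" using k(2) by linarith
  moreover have "finite ?W" using F X(1) by (auto simp: blocks_def)
  ultimately obtain A B y where AB: "A \<in> X" "B \<in> X" "A \<noteq> B" "y \<in> grow E ?W A r" "y \<in> grow E ?W B r"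
    using ex_meeting_pair[OF X \<open>M > 0\<close> k(1), of ?W] by blast
  have "A \<inter> B = {}" "B \<inter> A = {}" using X(2) AB by (auto simp: disjoint_def)
  from link_of_grow_meet[OF sym_E this(1) AB(4,5)] link_of_grow_meet[OF sym_E this(2) AB(5,4)]
  obtain P P' where P: "link E A B P" "P \<inter> ?W = {}" "finite P" "card P \<le> 2 * r"
    and P': "link E B A P'" "P' \<inter> ?W = {}" "finite P'" "card P' \<le> 2 * r" by blast
  have "P \<inter> F (A, B) = {}" "P' \<inter> F (B, A) = {}" using P(2) P'(2) AB(1,2) by auto
  then have "robust w A B" "robust w B A"
    using F[of "(A, B)"] F[of "(B, A)"] P P' by (auto simp: blocks_def)
  with neg AB show False by blast
qed

text \<open>
  A robust link has few vertices, so it cannot be hit by many disjoint groups of other units: a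
  group meeting every link (up to a small deleted set) must meet a small exceptional set \<open>Z\<close>.
\<close>

lemma robust_exceptional_set:
  assumes "robust ((2 * r + 1) * w) A B" "finite \<U>" "disjoint \<U>"
  shows "\<exists>Z. finite Z \<and> card Z \<le> t * (2 * r) \<and>
    (\<forall>S W. S \<subseteq> \<U> \<longrightarrow> card S \<le> t \<longrightarrow> S \<inter> Z = {} \<longrightarrow> finite W \<longrightarrow> card W \<le> w \<longrightarrow>
      (\<exists>P. link E A B P \<and> P \<inter> \<Union>S = {} \<and> P \<inter> W = {} \<and> finite P \<and> card P \<le> 2 * r))"
proof -
  define blocks where "blocks S W \<longleftrightarrow> finite W \<and> card W \<le> w \<and>
    (\<forall>P. link E A B P \<longrightarrow> finite P \<longrightarrow> card P \<le> 2 * r \<longrightarrow> P \<inter> W = {} \<longrightarrow> P \<inter> \<Union>S \<noteq> {})" for S W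
  define bad where "bad S \<longleftrightarrow> S \<subseteq> \<U> \<and> card S \<le> t \<and> (\<exists>W. blocks S W)" for S
  define fam where "fam \<F> \<longleftrightarrow> disjoint \<F> \<and> (\<forall>S\<in>\<F>. bad S)" for \<F>
  have fin: "finite \<F>" if "fam \<F>" for \<F>
  proof (rule finite_subset)
    show "\<F> \<subseteq> Pow \<U>" using that by (auto simp: fam_def bad_def)
  qed (use assms(2) in simp)
  \<comment> \<open>After deletion of the sets \<open>W\<close> of \<open>2 * r + 1\<close> disjoint
    bad groups, a link of at most \<open>2 * r\<close> vertices is left. It would have to meet every
    group, and in different vertices because units and groups are disjoint.\<close>
  have few: "card \<F> < Suc (2 * r)" if fam: "fam \<F>" for \<F>
  proof (rule ccontr)
    assume "\<not> ?thesis"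
    then obtain \<G> where G: "\<G> \<subseteq> \<F>" "card \<G> = 2 * r + 1" "finite \<G>"
      by (metis Suc_eq_plus1 not_less obtain_subset_with_card_n)
    have "\<forall>S\<in>\<G>. \<exists>W. blocks S W" using G(1) fam by (auto simp: fam_def bad_def)
    then obtain F where F: "\<And>S. S \<in> \<G> \<Longrightarrow> blocks S (F S)" by metis
    let ?W = "\<Union>S\<in>\<G>. F S"
    have "card ?W \<le> (\<Sum>S\<in>\<G>. card (F S))" by (rule card_UN_le[OF G(3)])
    also have "\<dots> \<le> card \<G> * w"
      using F by (intro sum_bounded_above[of \<G> _ w, simplified]) (auto simp: blocks_def)
    finally have "card ?W \<le> (2 * r + 1) * w" using G(2) by simp
    moreover have "finite ?W" using F G(3) by (auto simp: blocks_def)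
    ultimately obtain P where P: "link E A B P" "P \<inter> ?W = {}" "finite P" "card P \<le> 2 * r"
      using assms(1) unfolding robust_def by blast
    have "\<exists>p. p \<in> P \<inter> \<Union>S" if "S \<in> \<G>" for S
    proof -
      have "P \<inter> F S = {}" using P(2) that by auto
      then show ?thesis using F[OF that] P by (auto simp: blocks_def)
    qed
    then obtain p where p: "\<And>S. S \<in> \<G> \<Longrightarrow> p S \<in> P \<inter> \<Union>S" by metis
    have "inj_on p \<G>"
    proof
      fix S S' assume S: "S \<in> \<G>" "S' \<in> \<G>" "p S = p S'"
      with p obtain C C' where C: "C \<in> S" "p S \<in> C" "C' \<in> S'" "p S \<in> C'" by (metis IntD2 UnionE)
      have "C \<in> \<U>" "C' \<in> \<U>" using S(1,2) G(1) C fam by (auto simp: fam_def bad_def)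
      with C(2,4) assms(3) have "C = C'" by (auto simp: disjoint_def)
      with C S(1,2) G(1) fam show "S = S'" by (auto simp: fam_def disjoint_def)
    qed
    moreover have "p ` \<G> \<subseteq> P" using p by auto
    ultimately have "card \<G> \<le> card P" using P(3) by (rule card_inj_on_le)
    with P(4) G(2) show False by simp
  qed
  \<comment> \<open>The exceptional set is the union of a largest disjoint family of bad groups: a
    bad group missing this union could be added.\<close>
  have "\<exists>\<F>. fam \<F> \<and> (\<forall>\<G>. fam \<G> \<longrightarrow> card \<G> \<le> card \<F>)"
  proof (rule ex_has_greatest_nat)
    show "fam {}" by (simp add: fam_def disjoint_def)
    show "\<forall>\<F>. fam \<F> \<longrightarrow> card \<F> < Suc (2 * r)" using few by blast
  qed
  then obtain \<F> where F: "fam \<F>" and max: "\<And>\<G>. fam \<G> \<Longrightarrow> card \<G> \<le> card \<F>" by blast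
  \<comment> \<open>Robustness excludes an empty bad group, so adding a group that misses the union
    really enlarges the family.\<close>
  have nonempty: "S \<noteq> {}" if "bad S" for S
  proof
    assume "S = {}"
    with that obtain W where "finite W" "card W \<le> w"
      "\<And>P. link E A B P \<Longrightarrow> finite P \<Longrightarrow> card P \<le> 2 * r \<Longrightarrow> P \<inter> W \<noteq> {}"
      by (auto simp: bad_def blocks_def)
    moreover from \<open>card W \<le> w\<close> have "card W \<le> (2 * r + 1) * w" by simp
    ultimately show False using assms(1) unfolding robust_def by blast
  qed
  have "S \<inter> \<Union>\<F> \<noteq> {}" if S: "bad S" for S
  proof
    assume disj: "S \<inter> \<Union>\<F> = {}"
    then have "S \<notin> \<F>" using nonempty[OF S] by auto
    moreover have "fam (insert S \<F>)"
      using F S disj by (auto simp: fam_def disjoint_def)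
    from max[OF this] have "card (insert S \<F>) \<le> card \<F>" .
    ultimately show False using fin[OF F] by simp
  qed
  have "\<exists>P. link E A B P \<and> P \<inter> \<Union>S = {} \<and> P \<inter> W = {} \<and> finite P \<and> card P \<le> 2 * r"
    if SW: "S \<subseteq> \<U>" "card S \<le> t" "S \<inter> \<Union>\<F> = {}" "finite W" "card W \<le> w" for S W
  proof (rule ccontr)
    assume "\<not> ?thesis"
    then have "blocks S W" using SW(4,5) unfolding blocks_def by blast
    then have "bad S" using SW(1,2) unfolding bad_def by blast
    with \<open>\<And>S. bad S \<Longrightarrow> S \<inter> \<Union>\<F> \<noteq> {}\<close> SW(3) show False by blast
  qed
  moreover have "finite (\<Union>\<F>)"
    using F fin[OF F] assms(2) by (auto simp: fam_def bad_def intro: finite_subset)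
  moreover have "card (\<Union>\<F>) \<le> t * (2 * r)"
  proof -
    have "card (\<Union>\<F>) \<le> (\<Sum>S\<in>\<F>. card S)" using card_UN_le[OF fin[OF F], of "\<lambda>S. S"] by simp
    also have "\<dots> \<le> card \<F> * t"
      using F by (intro sum_bounded_above[of \<F> _ t, simplified]) (auto simp: fam_def bad_def)
    also have "\<dots> \<le> (2 * r) * t" using few[OF F] by (intro mult_right_mono) auto
    finally show ?thesis by (simp add: mult.commute)
  qed
  ultimately show ?thesis by blast
qed

text \<open>The conditions say that \<open>k\<close> large balls cannot be disjoint, that units are
  large compared with all blocking sets, that \<open>N\<close> units suffice for the first moment
  argument and can be found, and that units of size \<open>M\<close> can be grown. A branch set uses
  only short connections inside its unit, so its size is bounded independently of
  \<open>M\<close>.\<close>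

theorem ex_small_clique_minor:
  assumes k: "k > 0" "card V < k * Q"
    and M: "M > 0" "real (k ^ 2 * ((2 * r + 1) * (t * t * (2 * r)))) \<le> \<rho> / 2 * M"
    and N: "(k ^ t) ^ 3 * (t * (2 * r) + 1) < N" "real (N * M) \<le> \<rho> / 2 * s" "s + N * M \<le> card V"
    and s: "s > 0" "real (s * M) < Q"
  shows "\<exists>U\<subseteq>V. card U \<le> t * (t * (3 * r + 1)) \<and> clique_minor E t U"
proof -
  \<comment> \<open>Room for all earlier links: at most \<open>t * t\<close> of them, with at most
    \<open>2 * r\<close> vertices each.\<close>
  define w where "w = t * t * (2 * r)"
  define rob where "rob = robust ((2 * r + 1) * w)"
  obtain \<U> where U: "finite \<U>" "card \<U> = N" "disjoint \<U>"
    and unit: "\<And>A. A \<in> \<U> \<Longrightarrow> unit_set E r M A \<and> A \<subseteq> V"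
    using ex_many_unit_sets[OF M(1) s(1), of N] s(2) N(2,3) by auto
  have "\<exists>Z. finite Z \<and> card Z \<le> t * (2 * r) \<and> (rob A B \<longrightarrow>
    (\<forall>S W. S \<subseteq> \<U> \<longrightarrow> card S \<le> t \<longrightarrow> S \<inter> Z = {} \<longrightarrow> finite W \<longrightarrow> card W \<le> w \<longrightarrow>
      (\<exists>P. link E A B P \<and> P \<inter> \<Union>S = {} \<and> P \<inter> W = {} \<and> finite P \<and> card P \<le> 2 * r)))" for A B
  proof (cases "rob A B")
    case True
    then show ?thesis
      using robust_exceptional_set[OF _ U(1,3), of w A B t] unfolding rob_def by simp
  qed (auto intro: exI[of _ "{}"])
  then obtain Z where Z: "\<And>A B. finite (Z A B) \<and> card (Z A B) \<le> t * (2 * r)"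
    and clean: "\<And>A B S W. rob A B \<Longrightarrow> S \<subseteq> \<U> \<Longrightarrow> card S \<le> t \<Longrightarrow> S \<inter> Z A B = {} \<Longrightarrow> finite W \<Longrightarrow>
      card W \<le> w \<Longrightarrow> \<exists>P. link E A B P \<and> P \<inter> \<Union>S = {} \<and> P \<inter> W = {} \<and> finite P \<and> card P \<le> 2 * r"
    by metis
  \<comment> \<open>Freeness from the exceptional sets passes to subsets, so it is arranged first,
    for \<open>k ^ t\<close> units; the Ramsey argument then picks \<open>t\<close> of
    these.\<close>
  obtain X where X: "X \<subseteq> \<U>" "card X = k ^ t"
    and free: "\<And>A B C. A \<in> X \<Longrightarrow> B \<in> X \<Longrightarrow> C \<in> X \<Longrightarrow> C \<noteq> A \<Longrightarrow> C \<noteq> B \<Longrightarrow> C \<notin> Z A B"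
    using free_set[OF U(1), of Z "t * (2 * r)" "k ^ t"] Z N(1) U(2) by auto
  have "\<exists>Y\<subseteq>X. finite Y \<and> card Y = t \<and> (\<forall>A\<in>Y. \<forall>B\<in>Y. A \<noteq> B \<longrightarrow>
    (rob A B \<and> rob B A) \<or> (rob B A \<and> rob A B))"
  proof (rule ramsey_clique[OF k(1)])
    fix X' assume X': "X' \<subseteq> X" "finite X'" "card X' = k"
    have "disjoint X'" using U(3) X(1) X'(1) by (meson disjoint_def subsetD)
    moreover have "A \<subseteq> V \<and> card A = M" if "A \<in> X'" for A
      using unit[of A] that X' X(1) by (auto simp: unit_set_def)
    moreover have "real (card X' ^ 2 * ((2 * r + 1) * w)) \<le> \<rho> / 2 * M"
      using M(2) unfolding w_def X'(3) .
    ultimately have "\<exists>A\<in>X'. \<exists>B\<in>X'. A \<noteq> B \<and> rob A B \<and> rob B A"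
      unfolding rob_def using X' k(2) M(1) by (intro ex_robust_pair) auto
    then show "\<exists>A\<in>X'. \<exists>B\<in>X'. A \<noteq> B \<and> ((rob A B \<and> rob B A) \<or> (rob B A \<and> rob A B))"
      by blast
  qed (use X U(1) finite_subset in auto)
  then obtain Y where Y: "Y \<subseteq> X" "finite Y" "card Y = t"
    and rob: "\<And>A B. A \<in> Y \<Longrightarrow> B \<in> Y \<Longrightarrow> A \<noteq> B \<Longrightarrow> rob A B" by blast
  obtain u where u: "bij_betw u {..<t} Y"
    using ex_bij_betw_nat_finite[OF Y(2)] Y(3) by (auto simp: atLeast0LessThan)
  have uY: "u i \<in> Y" if "i < t" for i using u that by (auto simp: bij_betw_def)
  then have uU: "u i \<in> \<U>" if "i < t" for i using Y(1) X(1) that by blast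
  have u_neq: "u i \<noteq> u j" if "i < t" "j < t" "i \<noteq> j" for i j
    using u that by (auto simp: bij_betw_def inj_on_def)
  have u_disj: "u i \<inter> u j = {}" if "i < t" "j < t" "i \<noteq> j" for i j
    using uU[OF that(1)] uU[OF that(2)] u_neq[OF that] U(3) by (auto simp: disjoint_def)
  define I where "I = {(i, j). i < t \<and> j < i}"
  have I: "I \<subseteq> {..<t} \<times> {..<t}" by (auto simp: I_def)
  then have cI: "finite I" "card I \<le> t * t"
    using finite_subset[OF I] card_mono[OF _ I] by (auto simp: card_cartesian_product)
  have "\<exists>P. (\<forall>e\<in>I. (link E (u (fst e)) (u (snd e)) (P e) \<and> (\<forall>m<t. P e \<inter> u m = {})) \<and>
    finite (P e) \<and> card (P e) \<le> 2 * r) \<and> disjoint_family_on P I"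
  proof (rule disjoint_selection[where w = w, OF cI(1)])
    fix e and W :: "'a set"
    assume e: "e \<in> I" and W: "finite W" "card W \<le> w"
    obtain i j where ij: "e = (i, j)" "i < t" "j < i" using e by (auto simp: I_def)
    \<comment> \<open>The other chosen units form a group of at most \<open>t\<close>, to be avoided
      by the link between \<open>u i\<close> and \<open>u j\<close>.\<close>
    let ?S = "Y - {u i, u j}"
    have S: "?S \<subseteq> \<U>" "card ?S \<le> t"
      using Y X(1) card_mono[of Y ?S] by auto
    have S_free: "?S \<inter> Z (u i) (u j) = {}"
      using free[of "u i" "u j"] uY[of i] uY[of j] ij Y(1) by auto
    have "rob (u i) (u j)"
      using rob uY[of i] uY[of j] u_neq[of i j] ij by simp
    from clean[OF this S S_free W] obtain P where P: "link E (u i) (u j) P" "P \<inter> \<Union>?S = {}" "P \<inter> W = {}" "finite P"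
        "card P \<le> 2 * r" by blast
    have "P \<inter> u m = {}" if "m < t" for m
    proof (cases "u m \<in> {u i, u j}")
      case True
      with P(1) show ?thesis by (auto simp: link_def)
    next
      case False
      with uY[OF that] P(2) show ?thesis by blast
    qed
    with P ij(1) show "\<exists>P. (link E (u (fst e)) (u (snd e)) P \<and> (\<forall>m<t. P \<inter> u m = {})) \<and>
      P \<inter> W = {} \<and> finite P \<and> card P \<le> 2 * r" by auto
  next
    show "card I * (2 * r) \<le> w" using cI(2) unfolding w_def by (rule mult_right_mono) simp
  qed
  then obtain P where P: "\<And>i j. i < t \<Longrightarrow> j < i \<Longrightarrow> link E (u i) (u j) (P (i, j))"
      "\<And>i j m. i < t \<Longrightarrow> j < i \<Longrightarrow> m < t \<Longrightarrow> P (i, j) \<inter> u m = {}"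
      "\<And>i j. i < t \<Longrightarrow> j < i \<Longrightarrow> finite (P (i, j)) \<and> card (P (i, j)) \<le> 2 * r"
    and Pdisj: "disjoint_family_on P I"
    unfolding I_def by fastforce
  have "\<exists>a b p. a \<in> u i \<and> b \<in> u j \<and> p \<in> insert a (P (i, j)) \<and> linked E (insert a (P (i, j))) \<and> (p, b) \<in> E"
    if "i < t" "j < i" for i j
    using P(1)[OF that] unfolding link_def by blast
  then obtain a b p where abp: "\<And>i j. i < t \<Longrightarrow> j < i \<Longrightarrow> a i j \<in> u i \<and> b i j \<in> u j \<and>
      p i j \<in> insert (a i j) (P (i, j)) \<and> linked E (insert (a i j) (P (i, j))) \<and> (p i j, b i j) \<in> E"
    by metis
  have "\<exists>v\<in>u i. rooted E (Suc r) v (u i)" if "i < t" for i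
    using unit[OF uU[OF that]] by (auto simp: unit_set_def)
  then obtain v where v: "\<And>i. i < t \<Longrightarrow> v i \<in> u i \<and> rooted E (Suc r) (v i) (u i)" by metis
  have "\<exists>T\<subseteq>u i. linked E T \<and> v i \<in> T \<and> x \<in> T \<and> finite T \<and> card T \<le> Suc r"
    if "i < t" "x \<in> u i" for i x
    using v[OF that(1)] that(2) unfolding rooted_def by blast
  then obtain T where T: "\<And>i x. i < t \<Longrightarrow> x \<in> u i \<Longrightarrow> T i x \<subseteq> u i \<and> linked E (T i x) \<and> v i \<in> T i x \<and>
      x \<in> T i x \<and> finite (T i x) \<and> card (T i x) \<le> Suc r"
    by metis
  \<comment> \<open>The piece of branch set \<open>i\<close> that serves the pair of
    \<open>i\<close> and \<open>m\<close>: a short connection inside the unit from the root to the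
    attaching vertex. The link itself goes to the larger index; for \<open>m = i\<close> only the
    root is left.\<close>
  define G where "G i m = (if m < i then T i (a i m) \<union> insert (a i m) (P (i, m))
    else if i < m then T i (b m i) else {v i})" for i m
  have G_below: "T i (a i m) \<union> insert (a i m) (P (i, m)) = G i m" if "m < i" for i m
    using that by (simp add: G_def)
  have G_linked: "linked E (G i m) \<and> v i \<in> G i m" if "i < t" "m < t" for i m
  proof (cases m i rule: linorder_cases)
    case less
    with T[of i "a i m"] abp[of i m] that
    have "linked E (T i (a i m))" "linked E (insert (a i m) (P (i, m)))"
      and T': "a i m \<in> T i (a i m)" "v i \<in> T i (a i m)" by auto
    then have "linked E (T i (a i m) \<union> insert (a i m) (P (i, m)))"
      by (intro linked_Un_common[of _ _ _ "a i m"]) auto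
    with T'(2) show ?thesis unfolding G_below[OF less] using G_below[OF less] by blast
  next
    case greater
    with T[of i "b m i"] abp[of m i] that show ?thesis by (auto simp: G_def)
  qed (auto simp: G_def)
  have G_sub: "G i m \<subseteq> u i \<union> (if m < i then P (i, m) else {})" if "i < t" "m < t" for i m
  proof (cases m i rule: linorder_cases)
    case less
    with T[of i "a i m"] abp[of i m] that show ?thesis by (auto simp: G_def)
  next
    case greater
    with T[of i "b m i"] abp[of m i] that show ?thesis by (auto simp: G_def)
  next
    case equal
    with v[of i] that show ?thesis by (auto simp: G_def)
  qed
  have G_card: "card (G i m) \<le> 3 * r + 1" if "i < t" "m < t" for i m
  proof (cases m i rule: linorder_cases)
    case less
    then have "G i m = T i (a i m) \<union> P (i, m)"
      using T[of i "a i m"] abp[of i m] that by (auto simp: G_def)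
    then have "card (G i m) \<le> card (T i (a i m)) + card (P (i, m))" by (simp add: card_Un_le)
    also have "\<dots> \<le> Suc r + 2 * r"
      using less T[of i "a i m"] abp[of i m] P(3)[of i m] that by (intro add_mono) auto
    finally show ?thesis by simp
  next
    case greater
    with T[of i "b m i"] abp[of m i] that show ?thesis by (auto simp: G_def)
  qed (simp add: G_def)
  \<comment> \<open>\<open>link\<close> does not confine its inner vertices to \<open>V\<close>;
    connectivity to the root, which lies in \<open>V\<close>, does.\<close>
  have GV: "G i m \<subseteq> V" if "i < t" "m < t" for i m
    using linked_subset[of E "G i m" V "v i"] G_linked[OF that] E_V v[OF that(1)] unit[OF uU[OF that(1)]]
    by blast
  define B where "B i = (\<Union>m<t. G i m)" for i
  have "B i \<subseteq> V \<and> linked E (B i)" if "i < t" for i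
  proof
    show "B i \<subseteq> V" using GV[OF that] by (auto simp: B_def)
    show "linked E (B i)"
      unfolding B_def using G_linked[OF that] that by (intro linked_UN[of _ _ _ "v i"]) auto
  qed
  moreover have "disjoint_family_on B {..<t}"
    unfolding disjoint_family_on_def
  proof (intro ballI impI)
    fix i j assume "i \<in> {..<t}" "j \<in> {..<t}" and neq: "i \<noteq> j"
    then have ij: "i < t" "j < t" by auto
    have "G i m \<inter> G j m' = {}" if m: "m < t" "m' < t" for m m'
    proof -
      have "P (i, m) \<inter> P (j, m') = {}" if "m < i" "m' < j"
        using Pdisj neq that ij by (auto simp: disjoint_family_on_def I_def)
      moreover have "P (i, m) \<inter> u j = {}" if "m < i" using P(2) that ij by blast
      moreover have "P (j, m') \<inter> u i = {}" if "m' < j" using P(2) that ij by blast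
      ultimately have "(u i \<union> (if m < i then P (i, m) else {})) \<inter>
          (u j \<union> (if m' < j then P (j, m') else {})) = {}"
        using u_disj[OF ij neq] by (auto split: if_splits)
      then show ?thesis using G_sub[OF ij(1) m(1)] G_sub[OF ij(2) m(2)] by blast
    qed
    then show "B i \<inter> B j = {}" by (auto simp: B_def)
  qed
  moreover have "\<exists>x\<in>B i. \<exists>y\<in>B j. (x, y) \<in> E" if ij: "i < t" "j < i" for i j
  proof (intro bexI)
    show "(p i j, b i j) \<in> E" using abp[OF ij] by blast
    have "b i j \<in> G j i" using T[of j "b i j"] abp[OF ij] ij by (auto simp: G_def)
    then show "b i j \<in> B j" using ij by (auto simp: B_def)
    have "p i j \<in> G i j" using abp[OF ij] ij by (auto simp: G_def)
    then show "p i j \<in> B i" using ij by (auto simp: B_def)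
  qed
  ultimately have "clique_minor E t (\<Union>i<t. B i)"
    unfolding clique_minor_def by (intro exI[of _ B]) blast
  moreover have "(\<Union>i<t. B i) \<subseteq> V" using GV by (auto simp: B_def)
  moreover have "card (\<Union>i<t. B i) \<le> t * (t * (3 * r + 1))"
  proof -
    have "card (B i) \<le> t * (3 * r + 1)" if "i < t" for i
    proof -
      have "card (B i) \<le> (\<Sum>m<t. card (G i m))" unfolding B_def by (rule card_UN_le) simp
      also have "\<dots> \<le> t * (3 * r + 1)"
        using sum_bounded_above[of "{..<t}" "\<lambda>m. card (G i m)" "3 * r + 1"] G_card[OF that] by simp
      finally show ?thesis .
    qed
    then have "(\<Sum>i<t. card (B i)) \<le> t * (t * (3 * r + 1))"
      using sum_bounded_above[of "{..<t}" "\<lambda>i. card (B i)" "t * (3 * r + 1)"] by simp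
    moreover have "card (\<Union>i<t. B i) \<le> (\<Sum>i<t. card (B i))" by (rule card_UN_le) simp
    ultimately show ?thesis by linarith
  qed
  ultimately show ?thesis by blast
qed

end

section \<open>Dense subgraphs that expand\<close>

lemma ex_minimal_dense_subset:
  fixes \<theta> :: "nat \<Rightarrow> real"
  assumes "finite V\<^sub>0" "V\<^sub>0 \<noteq> {}" "\<theta> (card V\<^sub>0) * card V\<^sub>0 \<le> card (E \<inter> V\<^sub>0 \<times> V\<^sub>0)"
  shows "\<exists>V\<subseteq>V\<^sub>0. V \<noteq> {} \<and> \<theta> (card V) * card V \<le> card (E \<inter> V \<times> V) \<and>
    (\<forall>U. U \<subset> V \<longrightarrow> U \<noteq> {} \<longrightarrow> card (E \<inter> U \<times> U) < \<theta> (card U) * card U)"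
proof -
  define P where "P V \<longleftrightarrow> V \<subseteq> V\<^sub>0 \<and> V \<noteq> {} \<and> \<theta> (card V) * card V \<le> card (E \<inter> V \<times> V)" for V
  have "P V\<^sub>0" using assms(2,3) by (simp add: P_def)
  from ex_has_least_nat[of P, OF this, of card] obtain V
    where V: "P V" "\<And>U. P U \<Longrightarrow> card V \<le> card U" by blast
  have "card (E \<inter> U \<times> U) < \<theta> (card U) * card U" if "U \<subset> V" "U \<noteq> {}" for U
  proof (rule ccontr)
    assume "\<not> ?thesis"
    with that V(1) have "P U" by (auto simp: P_def)
    with V(2) have "card V \<le> card U" by blast
    moreover have "finite V" using V(1) assms(1) by (auto simp: P_def intro: finite_subset)
    ultimately show False using psubset_card_mono[of V U] that(1) by simp
  qed
  with V(1) show ?thesis by (auto simp: P_def)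
qed

text \<open>
  Every edge lies in the closed neighbourhood of \<open>S\<close> or in the complement of \<open>S\<close>, and both are too
  sparse by minimality.
\<close>

lemma expansion_of_minimal:
  fixes \<theta> :: "nat \<Rightarrow> real"
  assumes V: "finite V" "E \<subseteq> V \<times> V" "sym E" and dense: "\<theta> (card V) * card V \<le> card E"
    and minimal: "\<And>U. U \<subset> V \<Longrightarrow> U \<noteq> {} \<Longrightarrow> card (E \<inter> U \<times> U) \<le> \<theta> (card U) * card U"
    and mono: "\<And>i. 0 < i \<Longrightarrow> i \<le> card V \<Longrightarrow> \<theta> i \<le> \<theta> (card V)"
    and S: "S \<subseteq> V" "S \<noteq> {}" and S': "S' = S \<union> E `` S" "S' \<noteq> V"
  shows "card S' * (\<theta> (card V) - \<theta> (card S')) \<le> \<theta> (card V) * card (E `` S - S)"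
proof -
  have sub: "S' \<subset> V" "S' \<noteq> {}" using S S' V(2) by auto
  have "E `` S - S \<subseteq> V" using V(2) by auto
  with S(1) sub(1) have fin: "finite S" "finite S'" "finite (E `` S - S)"
    using V(1) by (meson finite_subset psubset_imp_subset)+
  have compl: "V - S \<subset> V" "V - S \<noteq> {}" using S sub S'(1) by auto
  have "E \<subseteq> (E \<inter> S' \<times> S') \<union> (E \<inter> (V - S) \<times> (V - S))"
    using V(2,3) S'(1) by (auto dest: symD)
  then have "card E \<le> card ((E \<inter> S' \<times> S') \<union> (E \<inter> (V - S) \<times> (V - S)))"
    using fin V(1) by (intro card_mono) auto
  also have "\<dots> \<le> card (E \<inter> S' \<times> S') + card (E \<inter> (V - S) \<times> (V - S))"
    by (rule card_Un_le)
  finally have "real (card E) \<le> card (E \<inter> S' \<times> S') + card (E \<inter> (V - S) \<times> (V - S))"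
    by (simp flip: of_nat_add)
  also have "\<dots> \<le> \<theta> (card S') * card S' + \<theta> (card (V - S)) * card (V - S)"
    using minimal[OF sub] minimal[OF compl] by linarith
  also have "\<dots> \<le> \<theta> (card S') * card S' + \<theta> (card V) * card (V - S)"
    using compl V(1) by (intro add_left_mono mult_right_mono mono) (auto simp: card_gt_0_iff intro: card_mono)
  also have "real (card (V - S)) = real (card V) - real (card S)"
    using S(1) fin(1) V(1) by (simp add: card_Diff_subset card_mono of_nat_diff)
  finally have "\<theta> (card V) * card S \<le> \<theta> (card S') * card S'"
    using dense by (simp add: algebra_simps)
  moreover have "card S' = card S + card (E `` S - S)"
  proof -
    have "S' = S \<union> (E `` S - S)" using S'(1) by blast
    moreover have "card (S \<union> (E `` S - S)) = card S + card (E `` S - S)"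
      using fin by (intro card_Un_disjoint) auto
    ultimately show ?thesis by simp
  qed
  ultimately show ?thesis by (simp add: algebra_simps)
qed

section \<open>Choice of the parameters\<close>

text \<open>
  With \<open>X = m\<^bsup>1/g\<^esup>\<close>, all quantities polylogarithmic in \<open>m\<close> are at most \<open>X\<close>, so that \<open>k \<le> X\<^sup>2\<close>,
  \<open>M \<le> X\<^bsup>7\<^esup>\<close>, \<open>N \<le> X\<^bsup>6t+2\<^esup>\<close> and \<open>s \<le> X\<^bsup>6t+11\<^esup>\<close>; the value of \<open>g\<close> puts \<open>s M\<close> below
  \<open>X\<^bsup>g-1\<^esup>/2\<close>.
\<close>

lemma ex_expander_parameters:
  fixes t :: nat and \<kappa> :: real
  assumes "\<kappa> > 0"
  defines "g \<equiv> 6 * t + 20"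
  shows "\<exists>m\<^sub>0\<ge>3. \<forall>m\<ge>m\<^sub>0. \<forall>\<rho> r. \<kappa> * ln (real m) / (1 + ln (real m))\<^sup>2 \<le> \<rho> \<longrightarrow>
     real r \<le> 1 + 4 / \<kappa> * (1 + ln (real m))\<^sup>2 \<longrightarrow>
     (\<exists>k N M s :: nat. k > 0 \<and> m < k * (m powr (1 - 1 / g) / 2) \<and>
       M > 0 \<and> real (k ^ 2 * ((2 * r + 1) * (t * t * (2 * r)))) \<le> \<rho> / 2 * M \<and>
       (k ^ t) ^ 3 * (t * (2 * r) + 1) < N \<and> real (N * M) \<le> \<rho> / 2 * s \<and> s + N * M \<le> m \<and>
       s > 0 \<and> real (s * M) < m powr (1 - 1 / g) / 2)"
proof -
  define K where "K = 1 + 4 / \<kappa>"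
  have K: "K \<ge> 1" "4 / \<kappa> \<le> K" using assms by (auto simp: K_def)
  \<comment> \<open>Large enough to put the polylogarithmic quantities \<open>w\<close>,
    \<open>z\<close> and \<open>2 / \<rho>\<close> below \<open>X\<close> at once. The factor
    \<open>K\<^sup>2\<close> comes from \<open>w\<close>, which is quadratic in \<open>r\<close>,
    and \<open>r\<close> is at most \<open>K * L\<^sup>2\<close>.\<close>
  define C where "C = (6 * real t * real t + 2 * real t + 1) * K\<^sup>2"
  define h where "h = 1 / real g"
  have h: "h > 0" by (simp add: h_def g_def)
  have "eventually (\<lambda>x::real. C * (1 + ln x) ^ 4 \<le> x powr h) at_top"
    using h by real_asymp
  then have "eventually (\<lambda>m. C * (1 + ln (real m)) ^ 4 \<le> real m powr h) sequentially"
    by (rule eventually_compose_filterlim) (rule filterlim_real_sequentially)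
  then obtain m\<^sub>1 where m1: "\<And>m. m \<ge> m\<^sub>1 \<Longrightarrow> C * (1 + ln (real m)) ^ 4 \<le> real m powr h"
    by (auto simp: eventually_sequentially)
  have main: "\<exists>k N M s :: nat. k > 0 \<and> m < k * (m powr (1 - 1 / g) / 2) \<and>
       M > 0 \<and> real (k ^ 2 * ((2 * r + 1) * (t * t * (2 * r)))) \<le> \<rho> / 2 * M \<and>
       (k ^ t) ^ 3 * (t * (2 * r) + 1) < N \<and> real (N * M) \<le> \<rho> / 2 * s \<and> s + N * M \<le> m \<and>
       s > 0 \<and> real (s * M) < m powr (1 - 1 / g) / 2"
    if m: "max 3 m\<^sub>1 \<le> m" and rho: "\<kappa> * ln (real m) / (1 + ln (real m))\<^sup>2 \<le> \<rho>"
      and r: "real r \<le> 1 + 4 / \<kappa> * (1 + ln (real m))\<^sup>2" for m r :: nat and \<rho> :: real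
  proof -
    define L where "L = 1 + ln (real m)"
    define X where "X = real m powr h"
    \<comment> \<open>\<open>m \<ge> 3\<close> exceeds Euler's number, so \<open>L - 1\<close>, a
      denominator in the bound for \<open>2 / \<rho>\<close>, is at least 1.\<close>
    have "exp 1 \<le> real m" using m exp_le by (simp add: order_trans[OF exp_le])
    then have "1 \<le> ln (real m)" using m by (simp add: ln_ge_iff)
    then have L: "L \<ge> 2" and lnL: "ln (real m) = L - 1" by (auto simp: L_def)
    have C_L: "C * L ^ 4 \<le> X" using m1[of m] m by (simp add: X_def L_def)
    have L2: "L\<^sup>2 \<ge> 1" using L by (simp add: one_le_power)
    have L24: "L\<^sup>2 \<le> L ^ 4" using L by (intro power_increasing) auto
    have KK: "K \<le> K\<^sup>2" using K by (simp add: self_le_power)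
    have KL: "1 \<le> K * L\<^sup>2" using mult_mono[of 1 K 1 "L\<^sup>2"] K(1) L2 by simp
    have KL4: "K * L\<^sup>2 \<le> K\<^sup>2 * L ^ 4" using KK L24 K by (intro mult_mono) auto
    have r': "real r \<le> K * L\<^sup>2" using r L2 K_def by (simp add: L_def algebra_simps)
    have w: "real ((2 * r + 1) * (t * t * (2 * r))) \<le> X"
    proof -
      have "(2 * real r + 1) * (real t * real t * (2 * real r))
          \<le> (3 * (K * L\<^sup>2)) * (real t * real t * (2 * (K * L\<^sup>2)))"
        using r' KL by (intro mult_mono) auto
      also have "\<dots> = (6 * real t * real t) * (K\<^sup>2 * L ^ 4)" by (simp add: power2_eq_square power4_eq_xxxx)
      also have "\<dots> \<le> (6 * real t * real t + 2 * real t + 1) * (K\<^sup>2 * L ^ 4)"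
        by (intro mult_right_mono) auto
      also have "\<dots> \<le> X" using C_L by (simp add: C_def mult.assoc)
      finally show ?thesis by (simp only: of_nat_mult of_nat_add of_nat_1 of_nat_numeral)
    qed
    have z: "real (t * (2 * r) + 1) \<le> X"
    proof -
      have "real t * (2 * real r) + 1 \<le> real t * (2 * (K * L\<^sup>2)) + K * L\<^sup>2"
        using r' KL by (intro add_mono mult_left_mono) auto
      also have "\<dots> = (2 * real t + 1) * (K * L\<^sup>2)" by (simp add: algebra_simps)
      also have "\<dots> \<le> (6 * real t * real t + 2 * real t + 1) * (K\<^sup>2 * L ^ 4)"
        by (rule mult_mono[OF _ KL4]) (use KL in auto)
      also have "\<dots> \<le> X" using C_L by (simp add: C_def mult.assoc)
      finally show ?thesis by simp
    qed
    have KX: "K\<^sup>2 * L ^ 4 \<le> X"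
    proof -
      have "1 * (K\<^sup>2 * L ^ 4) \<le> (6 * real t * real t + 2 * real t + 1) * (K\<^sup>2 * L ^ 4)"
        by (intro mult_right_mono) auto
      then show ?thesis using C_L by (simp add: C_def mult.assoc)
    qed
    have X4: "X \<ge> 4"
    proof -
      have "2 ^ 4 \<le> L ^ 4" using L by (intro power_mono) auto
      moreover have "1 * L ^ 4 \<le> K\<^sup>2 * L ^ 4" using K(1) by (intro mult_right_mono) (auto simp: one_le_power)
      ultimately show ?thesis using KX by simp
    qed
    have base: "0 < \<kappa> * (L - 1) / L\<^sup>2" using assms(1) L by simp
    have rho_pos: "\<rho> > 0" using rho base unfolding lnL L_def[symmetric] by simp
    have rho_X: "2 / \<rho> \<le> X"
    proof -
      have "2 / \<rho> \<le> 2 / (\<kappa> * (L - 1) / L\<^sup>2)"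
        using rho unfolding lnL L_def[symmetric] by (intro frac_le[OF _ order_refl base]) simp_all
      also have "\<dots> = (2 / \<kappa>) * (L\<^sup>2 / (L - 1))" using L by simp
      also have "\<dots> \<le> K * L\<^sup>2"
      proof (intro mult_mono)
        show "2 / \<kappa> \<le> K" using K(2) assms(1) by (simp add: K_def field_simps)
        show "L\<^sup>2 / (L - 1) \<le> L\<^sup>2" using L by (simp add: divide_le_eq mult_le_cancel_left1)
      qed (use K L in auto)
      finally show ?thesis using KL4 KX by linarith
    qed
    have X_pow: "X ^ g = real m"
      using m by (simp add: X_def h_def g_def powr_realpow[symmetric] powr_powr)
    have "1 - 1 / real g = h * real (6 * t + 19)" by (simp add: h_def g_def field_simps)
    then have "real m powr (1 - 1 / real g) = X powr real (6 * t + 19)"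
      by (simp only: X_def powr_powr)
    then have X_Q: "real m powr (1 - 1 / real g) = X ^ (6 * t + 19)"
      using X4 by (simp only: powr_realpow)
    have X_mono: "X ^ i \<le> X ^ j" if "i \<le> j" for i j using X4 that by (intro power_increasing) auto
    \<comment> \<open>Absorbs the additive error of at most 2 from rounding up, at the price of one
      power of \<open>X\<close>.\<close>
    have X_step: "X ^ i + 2 \<le> X ^ Suc i" for i
    proof -
      have "1 \<le> X ^ i" using X4 by (intro one_le_power) simp
      then have "2 \<le> 3 * X ^ i" by simp
      moreover have "4 * X ^ i \<le> X * X ^ i" using X4 by (intro mult_right_mono) auto
      ultimately show ?thesis unfolding power_Suc by linarith
    qed
    \<comment> \<open>The covering condition asks for \<open>k > 2 * X\<close>; the factor 3 gives
      strictness.\<close>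
    define k where "k = nat \<lceil>3 * X\<rceil>"
    have k_ge: "3 * X \<le> k" unfolding k_def by (rule real_nat_ceiling_ge)
    have k_le: "k \<le> X ^ 2"
    proof -
      have "real k \<le> 3 * X + 1" using X4 by (simp add: k_def of_nat_nat)
      also have "\<dots> \<le> 4 * X" using X4 by simp
      also have "\<dots> \<le> X * X" using X4 by (intro mult_right_mono) auto
      finally show ?thesis by (simp add: power2_eq_square)
    qed
    define w where "w = (2 * r + 1) * (t * t * (2 * r))"
    \<comment> \<open>Solved from the condition on \<open>M\<close>, with \<open>+ 1\<close> for
      positivity; \<open>s\<close> is obtained in the same way.\<close>
    define M where "M = nat \<lceil>k ^ 2 * w * (2 / \<rho>)\<rceil> + 1"
    have M_ge: "k ^ 2 * w * (2 / \<rho>) \<le> M" unfolding M_def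
      using real_nat_ceiling_ge[of "k ^ 2 * w * (2 / \<rho>)"] by simp
    have nonneg: "0 \<le> k ^ 2 * w * (2 / \<rho>)" using rho_pos by simp
    have M_le: "M \<le> X ^ 7"
    proof -
      have "M \<le> k ^ 2 * w * (2 / \<rho>) + 2" using nonneg unfolding M_def by linarith
      also have "k ^ 2 * w * (2 / \<rho>) \<le> (X ^ 2) ^ 2 * X * X"
      proof -
        have k2: "real (k ^ 2) \<le> (X ^ 2) ^ 2" unfolding of_nat_power by (rule power_mono[OF k_le]) simp
        have w': "real w \<le> X" using w unfolding w_def .
        show ?thesis
          unfolding of_nat_mult by (rule mult_mono'[OF mult_mono'[OF k2 w'] rho_X]) (use rho_pos in auto)
      qed
      also have "(X ^ 2) ^ 2 * X * X + 2 = X ^ 6 + 2" by (simp add: eval_nat_numeral)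
      also have "\<dots> \<le> X ^ 7" using X_step[of 6] by simp
      finally show ?thesis by simp
    qed
    define N where "N = (k ^ t) ^ 3 * (t * (2 * r) + 1) + 1"
    have N_le: "N \<le> X ^ (6 * t + 2)"
    proof -
      have "real ((k ^ t) ^ 3 * (t * (2 * r) + 1)) \<le> ((X ^ 2) ^ t) ^ 3 * X"
      proof -
        have kt: "real ((k ^ t) ^ 3) \<le> ((X ^ 2) ^ t) ^ 3"
          unfolding of_nat_power using k_le by (intro power_mono) auto
        show ?thesis unfolding of_nat_mult[of "(k ^ t) ^ 3"] by (rule mult_mono'[OF kt z]) auto
      qed
      also have "\<dots> = X ^ (6 * t + 1)" by (simp add: power_mult[symmetric] mult.commute)
      finally show ?thesis using X_step[of "6 * t + 1"] by (simp add: N_def ac_simps)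
    qed
    define s where "s = nat \<lceil>N * M * (2 / \<rho>)\<rceil> + 1"
    have s_ge: "N * M * (2 / \<rho>) \<le> s" unfolding s_def
      using real_nat_ceiling_ge[of "N * M * (2 / \<rho>)"] by simp
    have NM_le: "real (N * M) \<le> X ^ (6 * t + 9)"
    proof -
      have "real N * real M \<le> X ^ (6 * t + 2) * X ^ 7" using N_le M_le X4 by (intro mult_mono) auto
      also have "\<dots> = X ^ (6 * t + 9)" by (subst power_add[symmetric]) (rule arg_cong[of _ _ "(^) X"], simp)
      finally show ?thesis by simp
    qed
    have s_le: "s \<le> X ^ (6 * t + 11)"
    proof -
      have "0 \<le> N * M * (2 / \<rho>)" using rho_pos by simp
      then have "s \<le> N * M * (2 / \<rho>) + 2" unfolding s_def by linarith
      also have "N * M * (2 / \<rho>) \<le> X ^ (6 * t + 9) * X"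
        using NM_le rho_X rho_pos X4 by (intro mult_mono) auto
      also have "X ^ (6 * t + 9) * X + 2 = X ^ (6 * t + 10) + 2"
          using power_Suc2[of X "6 * t + 9"] by (simp add: ac_simps)
      also have "\<dots> \<le> X ^ (6 * t + 11)" using X_step[of "6 * t + 10"] by (simp add: ac_simps)
      finally show ?thesis by simp
    qed
    have "k > 0" using k_ge X4 by (cases k) auto
    moreover have "m < k * (m powr (1 - 1 / g) / 2)"
    proof -
      have "real m = X * X ^ (6 * t + 19)" 
        unfolding X_pow[symmetric] g_def using power_Suc[of X "6 * t + 19"] by (simp add: ac_simps)
      also have "\<dots> < (3 * X / 2) * X ^ (6 * t + 19)" using X4 by (intro mult_strict_right_mono) auto
      also have "\<dots> \<le> (k / 2) * X ^ (6 * t + 19)" using k_ge X4 by (intro mult_right_mono) auto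
      finally show ?thesis unfolding X_Q by simp
    qed
    moreover have "M > 0" "s > 0" by (auto simp: M_def s_def)
    moreover have "real (k ^ 2 * w) \<le> \<rho> / 2 * M" using M_ge rho_pos by (simp add: field_simps)
    moreover have "(k ^ t) ^ 3 * (t * (2 * r) + 1) < N" by (simp add: N_def)
    moreover have "real (N * M) \<le> \<rho> / 2 * s" using s_ge rho_pos by (simp add: field_simps)
    moreover have "s + N * M \<le> m"
    proof -
      have "real (s + N * M) \<le> X ^ (6 * t + 11) + X ^ (6 * t + 11)"
        using s_le NM_le X_mono[of "6 * t + 9" "6 * t + 11"] by simp
      also have "\<dots> \<le> X * X ^ (6 * t + 11)"
        using X4 mult_right_mono[of 2 X "X ^ (6 * t + 11)"] by simp
      also have "\<dots> = X ^ (6 * t + 12)" using power_Suc[of X "6 * t + 11"] by (simp add: ac_simps)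
      also have "\<dots> \<le> real m" unfolding X_pow[symmetric] g_def by (rule X_mono) simp
      finally show ?thesis by (simp only: of_nat_le_iff)
    qed
    moreover have "real (s * M) < m powr (1 - 1 / g) / 2"
    proof -
      have "real s * real M \<le> X ^ (6 * t + 11) * X ^ 7" using s_le M_le X4 by (intro mult_mono) auto
      also have "\<dots> = X ^ (6 * t + 18)" by (subst power_add[symmetric]) (rule arg_cong[of _ _ "(^) X"], simp)
      also have "\<dots> < (X / 2) * X ^ (6 * t + 18)" using X4 by (simp add: field_simps)
      also have "\<dots> = X ^ (6 * t + 19) / 2" using power_Suc[of X "6 * t + 18"] by (simp add: ac_simps)
      finally show ?thesis unfolding X_Q by simp
    qed
    ultimately show ?thesis
      unfolding w_def by blast
  qed
  show ?thesis
    by (rule exI[of _ "max 3 m\<^sub>1"]) (use main in simp)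
qed

text \<open>The difference equals \<open>(b - a) / ((1 + a) * (1 + b))\<close>, where
  \<open>b - a \<ge> b / g\<close> and \<open>a \<le> b\<close>. It is applied with \<open>a\<close>
  and \<open>b\<close> the logarithms of the sizes of a small closed neighbourhood and of the whole
  subgraph.\<close>

lemma inverse_gap:
  fixes a b g :: real
  assumes "0 \<le> a" "a \<le> (1 - 1 / g) * b" "0 < b" "1 \<le> g"
  shows "b / g / (1 + b)\<^sup>2 \<le> 1 / (1 + a) - 1 / (1 + b)"
proof -
  have gap: "b / g \<le> b - a" using assms(2) by (simp add: algebra_simps)
  have pos: "0 < b / g" using assms by simp
  have "a \<le> b" using gap pos by linarith
  have "b / g / (1 + b)\<^sup>2 \<le> (b - a) / ((1 + a) * (1 + b))"
  proof (rule frac_le)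
    show "0 \<le> b - a" using \<open>a \<le> b\<close> by simp
    show "b / g \<le> b - a" by (rule gap)
    show "0 < (1 + a) * (1 + b)" using assms by simp
    show "(1 + a) * (1 + b) \<le> (1 + b)\<^sup>2"
      unfolding power2_eq_square using \<open>a \<le> b\<close> assms(3) by (intro mult_right_mono) auto
  qed
  also have "\<dots> = 1 / (1 + a) - 1 / (1 + b)"
    using assms by (simp add: field_simps)
  finally show ?thesis .
qed

section \<open>From dense graphs to small clique minors\<close>

lemma ex_small_clique_minor_of_dense:
  fixes c e :: real and t :: nat
  assumes c: "forces_complete_minor t c" "c \<ge> 0" and "e > 0"
  shows "\<exists>C. \<forall>(V :: 'a set) E. finite V \<longrightarrow> E \<subseteq> V \<times> V \<longrightarrow> sym E \<longrightarrow> irrefl E \<longrightarrow> card V \<ge> 2 \<longrightarrow>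
    (c + 2 * e) * card V \<le> card E \<longrightarrow> (\<exists>U\<subseteq>V. card U \<le> C * ln (card V) \<and> clique_minor E t U)"
proof -
  define g where "g = 6 * t + 20"
  define D where "D = c + 2 * e"
  \<comment> \<open>The gap in \<open>\<theta>\<close> contributes \<open>e / g\<close>, and the
    expansion estimate divides it by \<open>\<theta>\<close> of the whole subgraph, which is at most
    \<open>D\<close>.\<close>
  define \<kappa> where "\<kappa> = e / (g * D)"
  have D: "D > 0" "e \<le> D / 2" using c(2) \<open>e > 0\<close> by (auto simp: D_def)
  have g: "real g \<ge> 20" by (simp add: g_def)
  have kappa: "\<kappa> > 0" using D(1) \<open>e > 0\<close> g by (simp add: \<kappa>_def)
  have D_kappa: "D * \<kappa> = e / g" using D by (simp add: \<kappa>_def)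
  have kappa_le: "\<kappa> \<le> 1 / 2"
  proof -
    have "e / D \<le> 1 / 2" using D by (simp add: field_simps)
    then have "(e / D) / g \<le> (1 / 2) / 1" by (rule frac_le[rotated]) (use g in simp_all)
    then show ?thesis by (simp add: \<kappa>_def mult.commute)
  qed
  obtain m\<^sub>0 where m0: "m\<^sub>0 \<ge> 3" and params: "\<And>m \<rho> r. m \<ge> m\<^sub>0 \<Longrightarrow>
     \<kappa> * ln (real m) / (1 + ln (real m))\<^sup>2 \<le> \<rho> \<Longrightarrow>
     real r \<le> 1 + 4 / \<kappa> * (1 + ln (real m))\<^sup>2 \<Longrightarrow>
     (\<exists>k N M s :: nat. k > 0 \<and> m < k * (m powr (1 - 1 / g) / 2) \<and>
       M > 0 \<and> real (k ^ 2 * ((2 * r + 1) * (t * t * (2 * r)))) \<le> \<rho> / 2 * M \<and>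
       (k ^ t) ^ 3 * (t * (2 * r) + 1) < N \<and> real (N * M) \<le> \<rho> / 2 * s \<and> s + N * M \<le> m \<and>
       s > 0 \<and> real (s * M) < m powr (1 - 1 / g) / 2)"
    using ex_expander_parameters[OF kappa, of t] unfolding g_def by blast
  \<comment> \<open>The first summand covers subgraphs with fewer than \<open>m\<^sub>0\<close>
    vertices, the second the bound \<open>t * t * (3 * r + 1)\<close>. Division by
    \<open>ln 2\<close> turns constants into multiples of \<open>ln n\<close>, as
    \<open>n \<ge> 2\<close>.\<close>
  define C where "C = m\<^sub>0 / ln 2 + t * t * (4 / ln 2 + 12 / \<kappa>)"
  show ?thesis
  proof (intro exI[of _ C] allI impI)
    fix V\<^sub>0 :: "'a set" and E
    assume V0: "finite V\<^sub>0" "E \<subseteq> V\<^sub>0 \<times> V\<^sub>0" "sym E" "irrefl E" "2 \<le> card V\<^sub>0"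
      and dense: "(c + 2 * e) * card V\<^sub>0 \<le> card E"
    define n where "n = card V\<^sub>0"
    have ln_n: "ln 2 \<le> ln (real n)" using V0(5) by (simp add: n_def)
    then have ln_n_pos: "0 < ln (real n)" using ln_gt_zero[of "2 :: real"] by linarith
    \<comment> \<open>Increases from \<open>c\<close> at 1 to at most \<open>D\<close> at
      \<open>n\<close>. The gap of the term \<open>1 / (1 + ln i)\<close> depends on subgraph sizes
      alone and makes \<open>r\<close> polylogarithmic in \<open>m\<close>; the term
      \<open>ln i / ln n\<close> makes \<open>r\<close> at most of order
      \<open>ln n\<close>.\<close>
    define \<theta> where "\<theta> i = c + e * (1 - 1 / (1 + ln (real i)) + ln (real i) / ln (real n))" for i :: nat
    have theta_diff: "\<theta> j - \<theta> i = e * ((1 / (1 + ln (real i)) - 1 / (1 + ln (real j))) +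
        (ln (real j) - ln (real i)) / ln (real n))" for i j
      by (simp add: \<theta>_def algebra_simps diff_divide_distrib)
    have theta_mono: "\<theta> i \<le> \<theta> j" if "0 < i" "i \<le> j" for i j
    proof -
      have "0 \<le> ln (real i)" "ln (real i) \<le> ln (real j)" using that by auto
      then have "0 \<le> 1 / (1 + ln (real i)) - 1 / (1 + ln (real j))"
        "0 \<le> (ln (real j) - ln (real i)) / ln (real n)"
        using ln_n_pos by (auto intro!: divide_left_mono mult_pos_pos divide_nonneg_pos)
      then have "0 \<le> \<theta> j - \<theta> i" using \<open>e > 0\<close> unfolding theta_diff by (intro mult_nonneg_nonneg) auto
      then show ?thesis by simp
    qed
    have theta_n: "\<theta> n \<le> D"
    proof -
      have "1 - 1 / (1 + ln (real n)) + ln (real n) / ln (real n) \<le> 2" using ln_n_pos by simp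
      then have "e * (1 - 1 / (1 + ln (real n)) + ln (real n) / ln (real n)) \<le> e * 2"
        using \<open>e > 0\<close> by (intro mult_left_mono) auto
      then show ?thesis by (simp add: \<theta>_def D_def)
    qed
    have theta_ge: "c \<le> \<theta> i" if "0 < i" for i
      using theta_mono[of 1 i] that by (simp add: \<theta>_def)
    have "E \<inter> V\<^sub>0 \<times> V\<^sub>0 = E" using V0(2) by blast
    moreover have "\<theta> n * card V\<^sub>0 \<le> D * card V\<^sub>0" using theta_n by (intro mult_right_mono) auto
    ultimately have "\<theta> (card V\<^sub>0) * card V\<^sub>0 \<le> card (E \<inter> V\<^sub>0 \<times> V\<^sub>0)"
      using dense by (simp add: n_def D_def)
    moreover have "V\<^sub>0 \<noteq> {}" using V0(5) by auto
    ultimately obtain V where V: "V \<subseteq> V\<^sub>0" "V \<noteq> {}" "\<theta> (card V) * card V \<le> card (E \<inter> V \<times> V)"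
      and minimal: "\<And>U. U \<subset> V \<Longrightarrow> U \<noteq> {} \<Longrightarrow> card (E \<inter> U \<times> U) < \<theta> (card U) * card U"
      using ex_minimal_dense_subset[OF V0(1), of \<theta> E] by blast
    define m where "m = card V"
    define E' where "E' = E \<inter> V \<times> V"
    have finV: "finite V" using V(1) V0(1) by (rule finite_subset)
    have m_pos: "0 < m" using finV V(2) by (simp add: m_def card_gt_0_iff)
    have m_n: "m \<le> n" using V(1) V0(1) by (simp add: m_def n_def card_mono)
    have symE': "sym E'" using V0(3) by (auto simp: E'_def sym_def)
    have "\<exists>U\<subseteq>V. card U \<le> C * ln (real n) \<and> clique_minor E' t U"
    proof (cases "m < m\<^sub>0")
      case True
      have "c * card V \<le> card E'"
        using V(3) theta_ge[OF m_pos] mult_right_mono[of c "\<theta> m" "real m"] by (simp add: E'_def m_def)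
      moreover have "irrefl E'" using V0(4) by (auto simp: E'_def irrefl_def)
      ultimately have "clique_minor E' t V"
        using forces_complete_minorD[OF c(1) finV V(2) _ symE'] by (simp add: E'_def)
      moreover have "card V \<le> C * ln (real n)"
      proof -
        have "real (card V) \<le> m\<^sub>0" using True by (simp add: m_def)
        also have "m\<^sub>0 = m\<^sub>0 / ln 2 * ln 2" by simp
        also have "\<dots> \<le> C * ln (real n)"
          using ln_n kappa by (intro mult_mono) (auto simp: C_def)
        finally show ?thesis .
      qed
      ultimately show ?thesis by blast
    next
      case False
      define L where "L = 1 + ln (real m)"
      define \<rho> where "\<rho> = \<kappa> * (ln (real m) / L\<^sup>2 + ln (real m) / ln (real n))"
      define Q where "Q = real m powr (1 - 1 / g) / 2"
      \<comment> \<open>For \<open>\<rho> \<le> 1\<close>, \<open>ln (1 + \<rho> / 2)\<close> is at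
        least \<open>\<rho> / 4\<close>, so this many steps with growth factor
        \<open>1 + \<rho> / 2\<close> reach size \<open>m\<close>, which exceeds
        \<open>Q\<close>.\<close>
      define r where "r = nat \<lceil>4 * ln (real m) / \<rho>\<rceil>"
      have m3: "m \<ge> 3" using False m0 by simp
      then have "exp 1 \<le> real m" by (simp add: order_trans[OF exp_le])
      then have ln_m: "1 \<le> ln (real m)" using m3 by (simp add: ln_ge_iff)
      have ln_mn: "ln (real m) \<le> ln (real n)" using m_n m_pos by simp
      have L: "L \<ge> 2" using ln_m by (simp add: L_def)
      have rho_ge: "\<kappa> * (ln (real m) / L\<^sup>2) \<le> \<rho>" "\<kappa> * (ln (real m) / ln (real n)) \<le> \<rho>"
        using kappa ln_m ln_n_pos by (auto simp: \<rho>_def distrib_left)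
      have base: "0 < \<kappa> * (ln (real m) / L\<^sup>2)" "0 < \<kappa> * (ln (real m) / ln (real n))"
        using kappa ln_m L ln_n_pos by simp_all
      with rho_ge have rho_pos: "\<rho> > 0" by linarith
      have rho_le: "\<rho> \<le> 1"
      proof -
        have "L * 1 \<le> L\<^sup>2" unfolding power2_eq_square using L by (intro mult_left_mono) auto
        then have "ln (real m) / L\<^sup>2 \<le> 1" using L by (simp add: divide_le_eq L_def)
        moreover have "ln (real m) / ln (real n) \<le> 1" using ln_mn ln_n_pos by simp
        ultimately have "ln (real m) / L\<^sup>2 + ln (real m) / ln (real n) \<le> 2" by linarith
        then have "\<rho> \<le> (1 / 2) * 2"
          unfolding \<rho>_def using kappa_le kappa ln_m ln_n_pos by (intro mult_mono) auto
        then show ?thesis by simp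
      qed
      have r_ge: "4 * ln (real m) / \<rho> \<le> r" unfolding r_def by (rule real_nat_ceiling_ge)
      have r_le: "r \<le> 4 * ln (real m) / \<rho> + 1"
        using rho_pos ln_m unfolding r_def by (simp add: of_nat_nat)
      have r_le1: "r \<le> 1 + 4 / \<kappa> * L\<^sup>2"
      proof -
        have "4 * ln (real m) / \<rho> \<le> 4 * ln (real m) / (\<kappa> * (ln (real m) / L\<^sup>2))"
          by (rule frac_le[OF _ order_refl base(1) rho_ge(1)]) (use ln_m in simp)
        also have "\<dots> = 4 / \<kappa> * L\<^sup>2" using ln_m L by simp
        finally show ?thesis using r_le by simp
      qed
      have r_le2: "r \<le> 1 + 4 / \<kappa> * ln (real n)"
      proof -
        have "4 * ln (real m) / \<rho> \<le> 4 * ln (real m) / (\<kappa> * (ln (real m) / ln (real n)))"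
          by (rule frac_le[OF _ order_refl base(2) rho_ge(2)]) (use ln_m in simp)
        also have "\<dots> = 4 / \<kappa> * ln (real n)" using ln_m by simp
        finally show ?thesis using r_le by simp
      qed
      have Q2_less: "2 * Q < m" 
      proof -
        have "real m powr (1 - 1 / g) < real m powr 1" using m3 g by (intro powr_less_mono) auto
        then show ?thesis by (simp add: Q_def)
      qed
      interpret expander V E' \<rho> Q r
      proof
        show "finite V" "E' \<subseteq> V \<times> V" "sym E'" "0 < \<rho>"
          using finV symE' rho_pos by (auto simp: E'_def)
        show "Q \<le> (1 + \<rho> / 2) ^ r"
        proof -
          have "\<rho> / 4 \<le> \<rho> / 2 - (\<rho> / 2)\<^sup>2"
            using rho_le rho_pos mult_left_mono[of \<rho> 1 \<rho>] by (simp add: power2_eq_square field_simps)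
          also have "\<dots> \<le> ln (1 + \<rho> / 2)" using rho_le rho_pos by (intro ln_one_plus_pos_lower_bound) auto
          finally have lb: "\<rho> / 4 \<le> ln (1 + \<rho> / 2)" .
          have "ln (real m) = 4 * ln (real m) / \<rho> * (\<rho> / 4)" using rho_pos by simp
          also have "\<dots> \<le> r * ln (1 + \<rho> / 2)"
            using r_ge lb rho_pos ln_m by (intro mult_mono) auto
          finally have "ln (real m) \<le> ln ((1 + \<rho> / 2) ^ r)" using rho_pos by (simp add: ln_realpow)
          then have "real m \<le> (1 + \<rho> / 2) ^ r" using m_pos rho_pos by (simp add: ln_le_cancel_iff)
          moreover have "0 \<le> Q" by (simp add: Q_def)
          ultimately show ?thesis using Q2_less by linarith
        qed
        fix S assume S: "S \<subseteq> V" "S \<noteq> {}" "real (card S) \<le> Q"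
        define S' where "S' = S \<union> E' `` S"
        have "S' \<subseteq> V" using S(1) by (auto simp: S'_def E'_def)
        then have finS': "finite S'" "finite S" "finite (E' `` S - S)"
          using finV S(1) by (auto simp: S'_def intro: finite_subset)
        show "\<rho> * card S \<le> card (E' `` S - S)"
        \<comment> \<open>If \<open>S'\<close> exceeds twice \<open>Q\<close>, more than half of it
          lies outside \<open>S\<close>, and \<open>\<rho> \<le> 1\<close> suffices. Otherwise
          \<open>card S'\<close> is at most \<open>m powr (1 - 1 / g)\<close>, so the gap in
          \<open>\<theta>\<close> is large and minimality gives the expansion.\<close>
        proof (cases "card S' \<le> 2 * Q")
          case False
          have "S' = S \<union> (E' `` S - S)" by (auto simp: S'_def)
          then have "card S' \<le> card S + card (E' `` S - S)" by (metis card_Un_le)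
          then have "card S \<le> card (E' `` S - S)" using False S(3) by simp
          moreover have "\<rho> * card S \<le> 1 * real (card S)" using rho_le by (intro mult_right_mono) auto
          ultimately show ?thesis by simp
        next
          case True
          have ne: "S' \<noteq> V" using True Q2_less by (auto simp: m_def)
          have S'_pos: "0 < card S'" using finS' S(2) by (auto simp: card_gt_0_iff S'_def)
          define a where "a = ln (real (card S'))"
          have a: "0 \<le> a" using S'_pos by (simp add: a_def)
          have "real (card S') \<le> real m powr (1 - 1 / g)" using True by (simp add: Q_def)
          then have "a \<le> ln (real m powr (1 - 1 / g))"
            unfolding a_def using S'_pos m_pos by (subst ln_le_cancel_iff) simp_all
          then have a_le: "a \<le> (1 - 1 / g) * ln (real m)" by (simp add: ln_powr)
          have "e * (ln (real m) / g / L\<^sup>2 + ln (real m) / g / ln (real n)) \<le> \<theta> m - \<theta> (card S')"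
            unfolding theta_diff a_def[symmetric] L_def
          proof (intro mult_left_mono add_mono)
            show "ln (real m) / g / (1 + ln (real m))\<^sup>2 \<le> 1 / (1 + a) - 1 / (1 + ln (real m))"
              using inverse_gap[OF a a_le] ln_m g by simp
            have "ln (real m) / g \<le> ln (real m) - a" using a_le by (simp add: algebra_simps)
            then show "ln (real m) / g / ln (real n) \<le> (ln (real m) - a) / ln (real n)"
              using ln_n_pos by (intro divide_right_mono) auto
          qed (use \<open>e > 0\<close> in simp)
          moreover have "e * (ln (real m) / g / L\<^sup>2 + ln (real m) / g / ln (real n)) = D * \<rho>"
            unfolding \<rho>_def mult.assoc[symmetric] D_kappa
            using g ln_n_pos L by (simp add: field_simps)
          ultimately have gap: "D * \<rho> \<le> \<theta> m - \<theta> (card S')" by simp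
          have "card S' * (\<theta> (card V) - \<theta> (card S')) \<le> \<theta> (card V) * card (E' `` S - S)"
          proof (rule expansion_of_minimal[OF finV _ symE' _ _ _ S(1,2) S'_def ne])
            show "E' \<subseteq> V \<times> V" "\<theta> (card V) * card V \<le> card E'" using V(3) by (auto simp: E'_def)
            show "card (E' \<inter> U \<times> U) \<le> \<theta> (card U) * card U" if "U \<subset> V" "U \<noteq> {}" for U
            proof -
              have "E' \<inter> U \<times> U = E \<inter> U \<times> U" using that by (auto simp: E'_def)
              then show ?thesis using minimal[OF that] by simp
            qed
            show "\<theta> i \<le> \<theta> (card V)" if "0 < i" "i \<le> card V" for i using theta_mono that .
          qed
          moreover have "card S' * (D * \<rho>) \<le> card S' * (\<theta> (card V) - \<theta> (card S'))"
            using gap by (intro mult_left_mono) (auto simp: m_def)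
          moreover have "\<theta> (card V) * card (E' `` S - S) \<le> D * card (E' `` S - S)"
            using theta_mono[OF m_pos m_n] theta_n by (intro mult_right_mono) (auto simp: m_def)
          ultimately have "D * (\<rho> * card S') \<le> D * card (E' `` S - S)" by (simp add: mult.commute mult.left_commute)
          then have "\<rho> * card S' \<le> card (E' `` S - S)" using D(1) by simp
          moreover have "\<rho> * card S \<le> \<rho> * card S'"
            using rho_pos finS' by (intro mult_left_mono) (auto simp: S'_def intro!: card_mono)
          ultimately show ?thesis by linarith
        qed
      qed
      have "\<kappa> * ln (real m) / L\<^sup>2 \<le> \<rho>" using rho_ge(1) by simp
      then obtain k N M s :: nat where "k > 0" "m < k * Q" "M > 0"
        "real (k ^ 2 * ((2 * r + 1) * (t * t * (2 * r)))) \<le> \<rho> / 2 * M"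
        "(k ^ t) ^ 3 * (t * (2 * r) + 1) < N" "real (N * M) \<le> \<rho> / 2 * s" "s + N * M \<le> m"
        "s > 0" "real (s * M) < Q"
        using params[of m \<rho> r] False r_le1 unfolding L_def Q_def by auto
      then obtain U where U: "U \<subseteq> V" "card U \<le> t * (t * (3 * r + 1))" "clique_minor E' t U"
        using ex_small_clique_minor[of k M t N s] by (auto simp: m_def)
      have "real (card U) \<le> real (t * (t * (3 * r + 1)))" using U(2) by (rule of_nat_mono)
      also have "\<dots> = t * t * (3 * real r + 1)" by (simp add: algebra_simps)
      also have "\<dots> \<le> t * t * ((4 / ln 2 + 12 / \<kappa>) * ln (real n))"
      proof (intro mult_left_mono)
        have "4 \<le> 4 / ln 2 * ln (real n)" using ln_n by (simp add: field_simps)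
        moreover have "3 * (4 / \<kappa> * ln (real n)) = 12 / \<kappa> * ln (real n)" by simp
        ultimately show "3 * real r + 1 \<le> (4 / ln 2 + 12 / \<kappa>) * ln (real n)"
          using r_le2 unfolding distrib_right by linarith
      qed simp
      also have "\<dots> \<le> C * ln (real n)"
        using ln_n_pos by (simp add: C_def distrib_right mult.assoc)
      finally show ?thesis using U by blast
    qed
    then obtain U where "U \<subseteq> V" "card U \<le> C * ln (real n)" "clique_minor E' t U" by blast
    moreover from this(3) have "clique_minor E t U"
      by (rule clique_minor_mono) (auto simp: E'_def)
    ultimately show "\<exists>U\<subseteq>V\<^sub>0. card U \<le> C * ln (card V\<^sub>0) \<and> clique_minor E t U"
      using V(1) unfolding n_def by blast
  qed
qed

section \<open>Conclusion for graphs\<close>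

lemma has_complete_minor_withinI:
  fixes N :: real
  assumes G: "simple_graph G" and U: "U \<subseteq> pverts G" "card U \<le> N" "clique_minor (parcs G) t U" "t \<ge> 1"
  shows "has_complete_minor_within t G N"
proof -
  note G' = simple_graphD[OF G]
  let ?E = "parcs G \<inter> U \<times> U"
  let ?H = "\<lparr>pverts = U, parcs = ?E\<rparr>"
  \<comment> \<open>\<open>t \<ge> 1\<close> supplies a branch set, so \<open>U\<close> is nonempty,
    as \<open>simple_graph\<close> demands.\<close>
  from U(3) obtain B where "\<forall>i<t. B i \<subseteq> U \<and> linked (parcs G) (B i)"
    unfolding clique_minor_def by blast
  with U(4) have "B 0 \<subseteq> U" "linked (parcs G) (B 0)" by auto
  then have "U \<noteq> {}" by (auto simp: linked_def)
  moreover have "finite U" using U(1) G'(1) by (rule finite_subset)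
  moreover have symE: "sym ?E" using G'(4) by (auto simp: sym_def)
  moreover have "irrefl ?E" using G'(5) by (auto simp: irrefl_def)
  ultimately have H: "simple_graph ?H" by (intro simple_graphI) auto
  then have "wf_digraph (with_proj ?H)" "wf_digraph (with_proj G)"
    using G'(3) by (auto simp: wf_digraph_def)
  then have "subgraph (with_proj ?H) (with_proj G)"
    using U(1) by (auto simp: subgraph_def)
  moreover have "has_complete_minor t ?H"
    using minor_of_complete_graph_iff[of ?H t] symE clique_minor_restrict[OF U(3)] by simp
  ultimately show ?thesis
    unfolding has_complete_minor_within_def using H U(2) by auto
qed

theorem theorem1p1:
  fixes t :: nat and \<epsilon> :: real
  assumes "t \<ge> 1" and "\<epsilon> > 0"
  shows "\<exists>C :: real. \<forall>G :: 'a pair_pre_digraph. \<forall>n :: nat.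
           simple_graph G \<and> card (pverts G) = n \<and> avg_degree G \<ge> minor_threshold t + \<epsilon> \<longrightarrow>
           has_complete_minor_within t G (C * ln (real n))"
proof -
  let ?S = "{c. 0 \<le> c \<and> forces_complete_minor t c}"
  have ne: "?S \<noteq> {}" using forces_complete_minor_power[of t] by (auto intro!: exI[of _ "2 ^ t"])
  have bdd: "bdd_below ?S" by (rule bdd_belowI[of _ 0]) simp
  \<comment> \<open>The infimum is not assumed to be attained. An admissible \<open>c\<close> within
    \<open>\<epsilon> / 2\<close> of it is chosen, and the remaining \<open>\<epsilon> / 2\<close>
    is the excess \<open>2 * (\<epsilon> / 4)\<close>.\<close>
  have "Inf ?S < minor_threshold t + \<epsilon> / 2"
    using assms(2) by (simp add: minor_threshold_def)
  then obtain c where c: "c \<ge> 0" "forces_complete_minor t c" "c < minor_threshold t + \<epsilon> / 2"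
    using cInf_less_iff[OF ne bdd] by blast
  have "\<epsilon> / 4 > 0" using assms(2) by simp
  from ex_small_clique_minor_of_dense[OF c(2,1) this]
  obtain C where C: "\<And>(V :: 'a set) E. finite V \<Longrightarrow> E \<subseteq> V \<times> V \<Longrightarrow> sym E \<Longrightarrow> irrefl E \<Longrightarrow> card V \<ge> 2 \<Longrightarrow>
    (c + 2 * (\<epsilon> / 4)) * card V \<le> card E \<Longrightarrow> \<exists>U\<subseteq>V. card U \<le> C * ln (card V) \<and> clique_minor E t U"
    by blast
  show ?thesis
  proof (intro exI[of _ C] allI impI, elim conjE)
    fix G :: "'a pair_pre_digraph" and n
    assume G: "simple_graph G" and n: "card (pverts G) = n"
      and deg: "minor_threshold t + \<epsilon> \<le> avg_degree G"
    note G' = simple_graphD[OF G]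
    have n_pos: "n > 0" using G'(1,2) n by (auto simp: card_gt_0_iff)
    have "c + 2 * (\<epsilon> / 4) \<le> avg_degree G" using deg c(3) by simp
    then have dense: "(c + 2 * (\<epsilon> / 4)) * card (pverts G) \<le> card (parcs G)"
      using n n_pos unfolding avg_degree_eq[OF G] by (simp add: field_simps)
    \<comment> \<open>A graph on one vertex has average degree 0, below the required
      \<open>c + \<epsilon> / 2\<close>; excluding it secures \<open>ln n > 0\<close>.\<close>
    have "n \<noteq> 1"
    proof
      assume "n = 1"
      with n obtain x where "pverts G = {x}" by (metis card_1_singletonE)
      with G'(3,5) have "parcs G = {}" by (auto simp: irrefl_def)
      with dense n \<open>n = 1\<close> c(1) assms(2) show False by simp
    qed
    with n n_pos have "card (pverts G) \<ge> 2" by simp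
    from C[OF G'(1,3,4,5) this dense] obtain U where
      U: "U \<subseteq> pverts G" "card U \<le> C * ln (real n)" "clique_minor (parcs G) t U"
      using n by auto
    from has_complete_minor_withinI[OF G this assms(1)]
    show "has_complete_minor_within t G (C * ln (real n))" .
  qed
qed

end
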